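(* For every prime $p$ and every (finite) extraspecial $p$-group $G$, the complex group algebra $\mathbb{C}[G]$ is of Knutson type.
   Context: For a finite group $G$, a virtual $\mathbb{C}[G]$-module is an integer linear combination of simple $\mathbb{C}[G]$-modules (an element of the representation ring). The Knutson Index $\mathcal{K}(M)$ of a $\mathbb{C}[G]$-module $M$ is the smallest integer $n\ge1$ such that $M\otimes N\cong n\,\mathbb{C}[G]$ (equality in the representation ring) for some virtual $\mathbb{C}[G]$-module $N$. The group algebra $\mathbb{C}[G]$ is of Knutson type if $\mathcal{K}(M)=1$ for every simple $\mathbb{C}[G]$-module $M$. *)

theory Defs
  imports
    "HOL-Algebra.Coset"
    "HOL-Computational_Algebra.Primes"
    "Jordan_Normal_Form.VS_Connect"
begin

section \<open>Extraspecial groups\<close>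

definition group_center :: "('a, 'b) monoid_scheme \<Rightarrow> 'a set" where
  "group_center G = {z \<in> carrier G. \<forall>g \<in> carrier G. z \<otimes>\<^bsub>G\<^esub> g = g \<otimes>\<^bsub>G\<^esub> z}"

definition elementary_abelian :: "nat \<Rightarrow> ('a, 'b) monoid_scheme \<Rightarrow> bool" where
  "elementary_abelian p G \<longleftrightarrow>
     comm_group G \<and> (\<forall>x \<in> carrier G. x [^]\<^bsub>G\<^esub> p = \<one>\<^bsub>G\<^esub>)"

text \<open>
  Finiteness is part of the definition: \<^const>\<open>Coset.order\<close> is \<open>0\<close> for infinite carriers, hence
  \<open>Coset.order G = p ^ k\<close> with \<open>p\<close> prime excludes them.
\<close>

definition extraspecial :: "nat \<Rightarrow> ('a, 'b) monoid_scheme \<Rightarrow> bool" where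
  "extraspecial p G \<longleftrightarrow>
     group G \<and> (\<exists>k. Coset.order G = p ^ k) \<and>
     card (group_center G) = p \<and>
     elementary_abelian p (G Mod group_center G) \<and>
     carrier (G Mod group_center G) \<noteq> {\<one>\<^bsub>G Mod group_center G\<^esub>}"


section \<open>Finite-dimensional modules over the complex group algebra\<close>

text \<open>
  A \<open>\<complex>[G]\<close>-module of dimension \<open>n\<close> is given by the action of \<open>G\<close> on \<open>\<complex>\<^sup>n\<close>, i.e. by a
  homomorphism from \<open>G\<close> to \<open>GL\<^sub>n(\<complex>)\<close>. Dimension \<open>0\<close> is allowed. The values of such a function
  outside \<open>carrier G\<close> are irrelevant.
\<close>

type_synonym 'a rep = "'a \<Rightarrow> complex mat"

definition rep_dim :: "('a, 'b) monoid_scheme \<Rightarrow> 'a rep \<Rightarrow> nat" where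
  "rep_dim G \<rho> = dim_row (\<rho> \<one>\<^bsub>G\<^esub>)"

definition group_rep :: "('a, 'b) monoid_scheme \<Rightarrow> 'a rep \<Rightarrow> bool" where
  "group_rep G \<rho> \<longleftrightarrow>
     \<rho> \<in> hom G (units_of (ring_mat TYPE(complex) (rep_dim G \<rho>) ()))"

definition rep_iso :: "('a, 'b) monoid_scheme \<Rightarrow> 'a rep \<Rightarrow> 'a rep \<Rightarrow> bool" where
  "rep_iso G \<rho> \<sigma> \<longleftrightarrow>
     rep_dim G \<rho> = rep_dim G \<sigma> \<and>
     (\<exists>P \<in> Units (ring_mat TYPE(complex) (rep_dim G \<rho>) ()).
        \<forall>g \<in> carrier G. P * \<rho> g = \<sigma> g * P)"

definition simple_rep :: "('a, 'b) monoid_scheme \<Rightarrow> 'a rep \<Rightarrow> bool" where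
  "simple_rep G \<rho> \<longleftrightarrow>
     group_rep G \<rho> \<and> rep_dim G \<rho> \<noteq> 0 \<and>
     (\<forall>W. VectorSpace.subspace class_ring W (module_vec TYPE(complex) (rep_dim G \<rho>)) \<and>
          (\<forall>g \<in> carrier G. \<forall>w \<in> W. \<rho> g *\<^sub>v w \<in> W) \<longrightarrow>
          W = {0\<^sub>v (rep_dim G \<rho>)} \<or> W = carrier_vec (rep_dim G \<rho>))"

definition kronecker_mat :: "complex mat \<Rightarrow> complex mat \<Rightarrow> complex mat" where
  "kronecker_mat A B =
     mat (dim_row A * dim_row B) (dim_col A * dim_col B)
       (\<lambda>(i, j). A $$ (i div dim_row B, j div dim_col B) * B $$ (i mod dim_row B, j mod dim_col B))"

definition rep_tensor :: "'a rep \<Rightarrow> 'a rep \<Rightarrow> 'a rep" where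
  "rep_tensor \<rho> \<sigma> = (\<lambda>g. kronecker_mat (\<rho> g) (\<sigma> g))"

definition rep_sum :: "'a rep list \<Rightarrow> 'a rep" where
  "rep_sum \<rho>s = (\<lambda>g. diag_block_mat (map (\<lambda>\<rho>. \<rho> g) \<rho>s))"

text \<open>
  The group algebra as a left module over itself, in the basis \<open>carrier G\<close>; the enumeration of
  this basis is arbitrary, and a different one gives an isomorphic module.
\<close>

definition carrier_enum :: "('a, 'b) monoid_scheme \<Rightarrow> 'a list" where
  "carrier_enum G = (SOME xs. distinct xs \<and> set xs = carrier G)"

definition regular_rep :: "('a, 'b) monoid_scheme \<Rightarrow> 'a rep" where
  "regular_rep G =
     (\<lambda>g. mat (Coset.order G) (Coset.order G)
        (\<lambda>(i, j). if carrier_enum G ! i = g \<otimes>\<^bsub>G\<^esub> carrier_enum G ! j then 1 else 0))"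


section \<open>Virtual modules and the representation ring\<close>

text \<open>
  Formal integer linear combinations of modules, as lists of coefficient-module pairs. Splitting
  a combination by the sign of its coefficients presents it as a formal difference of two modules.
\<close>

type_synonym 'a rep_comb = "(int \<times> 'a rep) list"

definition pos_part :: "'a rep_comb \<Rightarrow> 'a rep list" where
  "pos_part X = concat (map (\<lambda>(c, \<rho>). replicate (nat c) \<rho>) X)"

definition neg_part :: "'a rep_comb \<Rightarrow> 'a rep list" where
  "neg_part X = concat (map (\<lambda>(c, \<rho>). replicate (nat (- c)) \<rho>) X)"

definition virtual_module :: "('a, 'b) monoid_scheme \<Rightarrow> 'a rep_comb \<Rightarrow> bool" where
  "virtual_module G X \<longleftrightarrow> (\<forall>(c, \<rho>) \<in> set X. simple_rep G \<rho>)"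

text \<open>
  Equality in the representation ring, the Grothendieck group of the monoid of isomorphism
  classes of modules under direct sum: \<open>[A] - [B] = [C] - [D]\<close> iff
  \<open>A \<oplus> D \<oplus> E \<cong> C \<oplus> B \<oplus> E\<close> for some module \<open>E\<close>.
\<close>

definition rep_ring_eq :: "('a, 'b) monoid_scheme \<Rightarrow> 'a rep_comb \<Rightarrow> 'a rep_comb \<Rightarrow> bool" where
  "rep_ring_eq G X Y \<longleftrightarrow>
     (\<exists>\<eta>. group_rep G \<eta> \<and>
        rep_iso G (rep_sum (pos_part X @ neg_part Y @ [\<eta>]))
                  (rep_sum (pos_part Y @ neg_part X @ [\<eta>])))"

definition comb_tensor :: "'a rep \<Rightarrow> 'a rep_comb \<Rightarrow> 'a rep_comb" where
  "comb_tensor \<rho> X = map (\<lambda>(c, \<sigma>). (c, rep_tensor \<rho> \<sigma>)) X"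


section \<open>The Knutson index\<close>

definition knutson_index :: "('a, 'b) monoid_scheme \<Rightarrow> 'a rep \<Rightarrow> nat" where
  "knutson_index G \<rho> =
     (LEAST n. 1 \<le> n \<and>
        (\<exists>N. virtual_module G N \<and>
             rep_ring_eq G (comb_tensor \<rho> N) [(int n, regular_rep G)]))"

definition knutson_type :: "('a, 'b) monoid_scheme \<Rightarrow> bool" where
  "knutson_type G \<longleftrightarrow> (\<forall>\<rho>. simple_rep G \<rho> \<longrightarrow> knutson_index G \<rho> = 1)"

end

theory Submission
  imports Defs "Jordan_Normal_Form.Char_Poly" "HOL-Computational_Algebra.Fundamental_Theorem_Algebra"
begin

text \<open>
  Let \<open>\<rho>\<close> be a simple module of dimension \<open>d\<close> of an extraspecial \<open>p\<close>-group \<open>G\<close>, and let \<open>Z\<close> be the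
  center of \<open>G\<close>, a group of order \<open>p\<close>. By Schur's lemma \<open>Z\<close> acts on \<open>\<rho>\<close> through scalars
  \<open>\<omega> z\<close>. What is wanted is a module \<open>N\<close> for which the product of the characters of \<open>\<rho>\<close> and \<open>N\<close> is
  \<open>\<bar>G\<bar>\<close> at \<open>\<one>\<close> and \<open>0\<close> elsewhere, the character of \<open>\<complex>[G]\<close>.

  If \<open>\<omega>\<close> is trivial, then \<open>\<rho>\<close> factors through the abelian group \<open>G/Z\<close>, so \<open>d = 1\<close>
  (\<open>simple_trivial_center_dim\<close>) and \<open>N = \<complex>[G]\<close> will do.

  Otherwise \<open>\<omega>\<close> is faithful, because \<open>Z\<close> has prime order (\<open>prime_center_hom_cases\<close>). An element \<open>g\<close>
  outside \<open>Z\<close> is conjugate to \<open>z g\<close> for some central \<open>z \<noteq> \<one>\<close>, and \<open>z\<close> multiplies the trace by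
  \<open>\<omega> z \<noteq> 1\<close>; hence the character of \<open>\<rho>\<close> vanishes outside \<open>Z\<close> (\<open>trace_off_center\<close>). Its norm
  being \<open>1\<close>, this yields \<open>d\<^sup>2 p = \<bar>G\<bar>\<close> (\<open>simple_faithful_center_dim\<close>). The argument uses no more
  about \<open>\<rho>\<close> than the faithfulness of \<open>\<omega>\<close>, so for \<open>0 < k < p\<close> every simple module on which \<open>Z\<close>
  acts through \<open>\<omega>\<^sup>k\<close> also has dimension \<open>d\<close>; one such module occurs in the \<open>k\<close>-th tensor
  power of \<open>\<rho>\<close> (\<open>simple_with_power_char\<close>). Let \<open>N\<close> be the sum of one of these for each \<open>k\<close> and of
  \<open>d\<close> copies of the trivial module. On \<open>Z\<close> the character of \<open>N\<close> is \<open>d \<Sum>k<p. \<omega>\<^sup>k\<close>, which is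
  \<open>d p\<close> at \<open>\<one>\<close> and vanishes at every other element. Multiplied by the character of \<open>\<rho>\<close>, which is
  supported on \<open>Z\<close>, it gives \<open>d\<^sup>2 p = \<bar>G\<bar>\<close> at \<open>\<one>\<close> and \<open>0\<close> elsewhere.

  Comparing characters is enough because complex representations with equal characters are
  isomorphic (\<open>equal_characters_iso\<close>). This is derived from complete reducibility (Maschke) and
  the orthogonality of the characters of simple modules (Schur). The inner product that is used
  pairs the values at \<open>g\<close> and \<open>inv g\<close>, so neither complex conjugation nor unitarity enters.
\<close>

section \<open>Matrices\<close>

definition mat_trace :: "complex mat \<Rightarrow> complex" where
  "mat_trace A = (\<Sum>i<dim_row A. A $$ (i, i))"

lemma mult_index_sum:
  assumes "A \<in> carrier_mat n m" "B \<in> carrier_mat m k" "i < n" "j < k"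
  shows "(A * B) $$ (i, j) = (\<Sum>l<m. A $$ (i, l) * B $$ (l, j))"
  using assms by (simp add: scalar_prod_def atLeast0LessThan)

lemma mat_trace_comm:
  assumes A: "A \<in> carrier_mat n m" and B: "B \<in> carrier_mat m n"
  shows "mat_trace (A * B) = mat_trace (B * A)"
proof -
  have "mat_trace (A * B) = (\<Sum>i<n. \<Sum>l<m. A $$ (i, l) * B $$ (l, i))"
    unfolding mat_trace_def using A B by (intro sum.cong) (auto simp: mult_index_sum[OF A B] simp del: index_mult_mat(1))
  also have "\<dots> = (\<Sum>l<m. \<Sum>i<n. B $$ (l, i) * A $$ (i, l))"
    by (subst sum.swap) (simp add: mult.commute)
  also have "\<dots> = mat_trace (B * A)"
    unfolding mat_trace_def using A B by (intro sum.cong) (auto simp: mult_index_sum[OF B A] simp del: index_mult_mat(1))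
  finally show ?thesis .
qed

lemma mat_trace_one [simp]: "mat_trace (1\<^sub>m n) = of_nat n"
  by (simp add: mat_trace_def)

lemma mat_trace_smult_one [simp]: "mat_trace (c \<cdot>\<^sub>m 1\<^sub>m n) = c * of_nat n"
  by (simp add: mat_trace_def)

lemma mat_trace_similar:
  assumes "A \<in> carrier_mat n n" "P \<in> carrier_mat n n" "Q \<in> carrier_mat n n" "B \<in> carrier_mat n n"
    and "Q * P = 1\<^sub>m n" "P * A = B * P"
  shows "mat_trace A = mat_trace B"
proof -
  have PQ: "P * Q = 1\<^sub>m n"
    by (rule mat_mult_left_right_inverse[OF assms(3,2,5)])
  have "A = Q * (P * A)"
    using assms(5) by (simp add: assoc_mult_mat[OF assms(3,2,1), symmetric] left_mult_one_mat[OF assms(1)])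
  hence "mat_trace A = mat_trace (Q * (B * P))" using assms(6) by simp
  also have "\<dots> = mat_trace ((B * P) * Q)"
    using assms by (intro mat_trace_comm[of _ n n]) auto
  also have "(B * P) * Q = B"
    using PQ by (simp add: assoc_mult_mat[OF assms(4,2,3)] right_mult_one_mat[OF assms(4)])
  finally show ?thesis .
qed

lemma sum_lessThan_add:
  fixes f :: "nat \<Rightarrow> 'c::comm_monoid_add"
  shows "(\<Sum>i<m + n. f i) = (\<Sum>i<m. f i) + (\<Sum>i<n. f (m + i))"
  by (induct n) (simp_all add: add.assoc)

lemma mat_trace_four_block:
  assumes "A \<in> carrier_mat n n" "D \<in> carrier_mat m m"
  shows "mat_trace (four_block_mat A B C D) = mat_trace A + mat_trace D"
  using assms by (simp add: mat_trace_def sum_lessThan_add)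

text \<open>The trace of \<open>X * Y\<close> is \<open>m\<close> and that of \<open>Y * X\<close> is \<open>n\<close>.\<close>

lemma two_sided_inverse_square:
  fixes X Y :: "complex mat"
  assumes "X \<in> carrier_mat m n" "Y \<in> carrier_mat n m" "X * Y = 1\<^sub>m m" "Y * X = 1\<^sub>m n"
  shows "m = n"
  using mat_trace_comm[of X m n Y] assms(1,2) assms(3,4) by simp

text \<open>Padding with zeros turns \<open>L\<close> and \<open>J\<close>, if \<open>m > n\<close>, into one-sided inverse square matrices, hence into
  two-sided inverse ones; but the padded \<open>J\<close> has a zero row.\<close>

lemma left_invertible_le:
  fixes J L :: "complex mat"
  assumes J: "J \<in> carrier_mat n m" and L: "L \<in> carrier_mat m n" and LJ: "L * J = 1\<^sub>m m"
  shows "m \<le> n"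
proof (rule ccontr)
  assume "\<not> m \<le> n"
  hence nm: "n < m" by simp
  define J' where "J' = mat m m (\<lambda>(i, j). if i < n then J $$ (i, j) else 0)"
  define L' where "L' = mat m m (\<lambda>(i, j). if j < n then L $$ (i, j) else 0)"
  have c: "J' \<in> carrier_mat m m" "L' \<in> carrier_mat m m" by (auto simp: J'_def L'_def)
  have "L' * J' = L * J"
  proof (rule eq_matI)
    fix i j assume "i < dim_row (L * J)" "j < dim_col (L * J)"
    hence ij: "i < m" "j < m" using J L by auto
    have "(L' * J') $$ (i, j) = (\<Sum>l<m. L' $$ (i, l) * J' $$ (l, j))"
      by (rule mult_index_sum[OF c(2,1) ij])
    also have "\<dots> = (\<Sum>l<n. L $$ (i, l) * J $$ (l, j))"
      by (rule sum.mono_neutral_cong_right) (use ij nm in \<open>auto simp: J'_def L'_def\<close>)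
    also have "\<dots> = (L * J) $$ (i, j)"
      by (rule mult_index_sum[OF L J ij, symmetric])
    finally show "(L' * J') $$ (i, j) = (L * J) $$ (i, j)" .
  qed (use c J L in auto)
  hence "J' * L' = 1\<^sub>m m" using mat_mult_left_right_inverse[OF c(2,1)] LJ by simp
  hence "(J' * L') $$ (n, n) = 1" using nm by simp
  moreover have "(J' * L') $$ (n, n) = 0"
    unfolding mult_index_sum[OF c nm nm] using nm by (intro sum.neutral) (auto simp: J'_def)
  ultimately show False by simp
qed

text \<open>Matrices of unspecified size form no additive monoid, so a sum of matrices carries the dimensions
  of its value; an empty sum would not determine them.\<close>

definition mat_sum :: "'g set \<Rightarrow> ('g \<Rightarrow> complex mat) \<Rightarrow> nat \<Rightarrow> nat \<Rightarrow> complex mat" where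
  "mat_sum S F n m = mat n m (\<lambda>(i, j). \<Sum>g\<in>S. F g $$ (i, j))"

lemma mat_sum_carrier [simp]: "mat_sum S F n m \<in> carrier_mat n m"
  by (simp add: mat_sum_def)

lemma mat_sum_dim [simp]: "dim_row (mat_sum S F n m) = n" "dim_col (mat_sum S F n m) = m"
  by (simp_all add: mat_sum_def)

lemma mat_sum_index [simp]:
  "i < n \<Longrightarrow> j < m \<Longrightarrow> mat_sum S F n m $$ (i, j) = (\<Sum>g\<in>S. F g $$ (i, j))"
  by (simp add: mat_sum_def)

lemma mat_sum_cong:
  "(\<And>g. g \<in> S \<Longrightarrow> F g = F' g) \<Longrightarrow> mat_sum S F n m = mat_sum S F' n m"
  by (simp add: mat_sum_def)

lemma mat_sum_reindex:
  assumes "bij_betw f S T"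
  shows "mat_sum T F n m = mat_sum S (\<lambda>g. F (f g)) n m"
  unfolding mat_sum_def by (simp add: sum.reindex_bij_betw[OF assms, symmetric])

lemma mult_mat_sum:
  assumes A: "A \<in> carrier_mat k n" and F: "\<And>g. g \<in> S \<Longrightarrow> F g \<in> carrier_mat n m"
  shows "A * mat_sum S F n m = mat_sum S (\<lambda>g. A * F g) k m"
proof (rule eq_matI)
  fix i j assume "i < dim_row (mat_sum S (\<lambda>g. A * F g) k m)" "j < dim_col (mat_sum S (\<lambda>g. A * F g) k m)"
  hence ij: "i < k" "j < m" by auto
  have "(A * mat_sum S F n m) $$ (i, j) = (\<Sum>l<n. \<Sum>g\<in>S. A $$ (i, l) * F g $$ (l, j))"
    unfolding mult_index_sum[OF A mat_sum_carrier ij] using ij by (simp add: sum_distrib_left)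
  also have "\<dots> = (\<Sum>g\<in>S. (A * F g) $$ (i, j))"
    by (subst sum.swap, rule sum.cong[OF refl]) (simp only: mult_index_sum[OF A F ij])
  finally show "(A * mat_sum S F n m) $$ (i, j) = mat_sum S (\<lambda>g. A * F g) k m $$ (i, j)"
    using ij by simp
qed (use A in auto)

lemma mat_sum_mult:
  assumes A: "A \<in> carrier_mat m k" and F: "\<And>g. g \<in> S \<Longrightarrow> F g \<in> carrier_mat n m"
  shows "mat_sum S F n m * A = mat_sum S (\<lambda>g. F g * A) n k"
proof (rule eq_matI)
  fix i j assume "i < dim_row (mat_sum S (\<lambda>g. F g * A) n k)" "j < dim_col (mat_sum S (\<lambda>g. F g * A) n k)"
  hence ij: "i < n" "j < k" by auto
  have "(mat_sum S F n m * A) $$ (i, j) = (\<Sum>l<m. \<Sum>g\<in>S. F g $$ (i, l) * A $$ (l, j))"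
    unfolding mult_index_sum[OF mat_sum_carrier A ij] using ij by (simp add: sum_distrib_right)
  also have "\<dots> = (\<Sum>g\<in>S. (F g * A) $$ (i, j))"
    by (subst sum.swap, rule sum.cong[OF refl]) (simp only: mult_index_sum[OF F A ij])
  finally show "(mat_sum S F n m * A) $$ (i, j) = mat_sum S (\<lambda>g. F g * A) n k $$ (i, j)"
    using ij by simp
qed (use A in auto)

lemma mat_trace_mat_sum:
  assumes "\<And>g. g \<in> S \<Longrightarrow> F g \<in> carrier_mat n n"
  shows "mat_trace (mat_sum S F n n) = (\<Sum>g\<in>S. mat_trace (F g))"
proof -
  have "(\<Sum>g\<in>S. mat_trace (F g)) = (\<Sum>g\<in>S. \<Sum>i<n. F g $$ (i, i))"
    unfolding mat_trace_def using assms by (intro sum.cong) auto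
  thus ?thesis unfolding mat_trace_def by (subst (asm) sum.swap) simp
qed

subsection \<open>Kronecker products\<close>

lemma kronecker_carrier [simp]:
  assumes "A \<in> carrier_mat n m" "B \<in> carrier_mat k l"
  shows "kronecker_mat A B \<in> carrier_mat (n * k) (m * l)"
  using assms by (auto simp: kronecker_mat_def)

lemma kronecker_index:
  assumes "A \<in> carrier_mat n m" "B \<in> carrier_mat k l" "i < n * k" "j < m * l"
  shows "kronecker_mat A B $$ (i, j) = A $$ (i div k, j div l) * B $$ (i mod k, j mod l)"
  using assms by (auto simp: kronecker_mat_def)

lemma div_mod_less:
  fixes i n k :: nat
  assumes "i < n * k"
  shows "i div k < n" "i mod k < k"
proof -
  show "i div k < n" using assms by (simp add: less_mult_imp_div_less)
  show "i mod k < k" using assms by (cases "k = 0") auto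
qed

text \<open>The index set of a Kronecker product is \<open>{..<n * k}\<close>, read as pairs through division with
  remainder.\<close>

lemma sum_div_mod:
  fixes f :: "nat \<Rightarrow> nat \<Rightarrow> 'c::comm_monoid_add"
  shows "(\<Sum>i<n * k. f (i div k) (i mod k)) = (\<Sum>a<n. \<Sum>b<k. f a b)"
proof (induct n)
  case (Suc n)
  have "(\<Sum>i<Suc n * k. f (i div k) (i mod k)) =
      (\<Sum>i<n * k. f (i div k) (i mod k)) + (\<Sum>i<k. f ((n * k + i) div k) ((n * k + i) mod k))"
    by (simp add: sum_lessThan_add add.commute[of k])
  also have "(\<Sum>i<k. f ((n * k + i) div k) ((n * k + i) mod k)) = (\<Sum>b<k. f n b)"
    by (intro sum.cong) auto
  finally show ?case using Suc by simp
qed simp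

lemma kronecker_mult:
  assumes A: "A \<in> carrier_mat n1 n2" and B: "B \<in> carrier_mat k1 k2"
    and C: "C \<in> carrier_mat n2 n3" and D: "D \<in> carrier_mat k2 k3"
  shows "kronecker_mat A B * kronecker_mat C D = kronecker_mat (A * C) (B * D)"
proof (rule eq_matI)
  fix i j assume "i < dim_row (kronecker_mat (A * C) (B * D))" "j < dim_col (kronecker_mat (A * C) (B * D))"
  hence ij: "i < n1 * k1" "j < n3 * k3" using A B C D by (auto simp: kronecker_mat_def)
  note dm = div_mod_less[OF ij(1)] div_mod_less[OF ij(2)]
  have "(kronecker_mat A B * kronecker_mat C D) $$ (i, j) =
     (\<Sum>l<n2 * k2. kronecker_mat A B $$ (i, l) * kronecker_mat C D $$ (l, j))"
    by (rule mult_index_sum[OF kronecker_carrier[OF A B] kronecker_carrier[OF C D] ij])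
  also have "\<dots> = (\<Sum>l<n2 * k2. (A $$ (i div k1, l div k2) * B $$ (i mod k1, l mod k2)) *
      (C $$ (l div k2, j div k3) * D $$ (l mod k2, j mod k3)))"
    using ij by (intro sum.cong) (auto simp: kronecker_index[OF A B] kronecker_index[OF C D])
  also have "\<dots> = (\<Sum>a<n2. \<Sum>b<k2. (A $$ (i div k1, a) * B $$ (i mod k1, b)) *
      (C $$ (a, j div k3) * D $$ (b, j mod k3)))"
    by (rule sum_div_mod)
  also have "\<dots> = (\<Sum>a<n2. A $$ (i div k1, a) * C $$ (a, j div k3)) *
      (\<Sum>b<k2. B $$ (i mod k1, b) * D $$ (b, j mod k3))"
    by (simp add: sum_product mult_ac)
  also have "\<dots> = kronecker_mat (A * C) (B * D) $$ (i, j)"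
    unfolding kronecker_index[OF mult_carrier_mat[OF A C] mult_carrier_mat[OF B D] ij]
      mult_index_sum[OF A C dm(1,3)] mult_index_sum[OF B D dm(2,4)] ..
  finally show "(kronecker_mat A B * kronecker_mat C D) $$ (i, j) = kronecker_mat (A * C) (B * D) $$ (i, j)" .
qed (use A B C D in \<open>auto simp: kronecker_mat_def\<close>)

lemma kronecker_smult_one:
  "kronecker_mat (a \<cdot>\<^sub>m 1\<^sub>m n) (b \<cdot>\<^sub>m 1\<^sub>m k) = (a * b) \<cdot>\<^sub>m 1\<^sub>m (n * k)"
proof (rule eq_matI)
  fix i j assume "i < dim_row ((a * b) \<cdot>\<^sub>m 1\<^sub>m (n * k) :: complex mat)"
    "j < dim_col ((a * b) \<cdot>\<^sub>m 1\<^sub>m (n * k) :: complex mat)"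
  hence ij: "i < n * k" "j < n * k" by auto
  note dm = div_mod_less[OF ij(1)] div_mod_less[OF ij(2)]
  have "i = j \<longleftrightarrow> i div k = j div k \<and> i mod k = j mod k"
    by (metis div_mult_mod_eq)
  thus "kronecker_mat (a \<cdot>\<^sub>m 1\<^sub>m n) (b \<cdot>\<^sub>m 1\<^sub>m k) $$ (i, j) = ((a * b) \<cdot>\<^sub>m 1\<^sub>m (n * k)) $$ (i, j)"
    using ij dm by (subst kronecker_index[of _ n n _ k k]) auto
qed (auto simp: kronecker_mat_def)

lemma mat_trace_kronecker:
  assumes A: "A \<in> carrier_mat n n" and B: "B \<in> carrier_mat k k"
  shows "mat_trace (kronecker_mat A B) = mat_trace A * mat_trace B"
proof -
  have "mat_trace (kronecker_mat A B) = (\<Sum>i<n * k. A $$ (i div k, i div k) * B $$ (i mod k, i mod k))"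
    unfolding mat_trace_def using kronecker_carrier[OF A B]
    by (intro sum.cong) (auto simp: kronecker_index[OF A B])
  also have "\<dots> = (\<Sum>a<n. \<Sum>b<k. A $$ (a, a) * B $$ (b, b))"
    by (rule sum_div_mod)
  also have "\<dots> = mat_trace A * mat_trace B"
    using A B by (simp add: mat_trace_def sum_product)
  finally show ?thesis .
qed

section \<open>Matrix representations\<close>

text \<open>The notion of a representation of dimension \<open>n\<close> without the detour through the unit group of
  the matrix ring: invertibility of the values follows from the three conditions.\<close>

definition is_rep :: "('a, 'b) monoid_scheme \<Rightarrow> nat \<Rightarrow> 'a rep \<Rightarrow> bool" where
  "is_rep G n \<rho> \<longleftrightarrow> (\<forall>g\<in>carrier G. \<rho> g \<in> carrier_mat n n) \<and> \<rho> \<one>\<^bsub>G\<^esub> = 1\<^sub>m n \<and>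
     (\<forall>g\<in>carrier G. \<forall>h\<in>carrier G. \<rho> (g \<otimes>\<^bsub>G\<^esub> h) = \<rho> g * \<rho> h)"

locale fin_group = group G for G :: "('a, 'b) monoid_scheme" (structure) +
  assumes fin: "finite (carrier G)"

lemma Units_ring_mat:
  "P \<in> Units (ring_mat TYPE(complex) n ()) \<longleftrightarrow>
     P \<in> carrier_mat n n \<and> (\<exists>Q\<in>carrier_mat n n. Q * P = 1\<^sub>m n \<and> P * Q = 1\<^sub>m n)"
  by (auto simp: Units_def ring_mat_simps)

lemma is_rep_carrier: "is_rep G n \<rho> \<Longrightarrow> g \<in> carrier G \<Longrightarrow> \<rho> g \<in> carrier_mat n n"
  by (simp add: is_rep_def)

lemma is_rep_one: "is_rep G n \<rho> \<Longrightarrow> \<rho> \<one>\<^bsub>G\<^esub> = 1\<^sub>m n"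
  by (simp add: is_rep_def)

lemma is_rep_mult:
  "is_rep G n \<rho> \<Longrightarrow> g \<in> carrier G \<Longrightarrow> h \<in> carrier G \<Longrightarrow> \<rho> (g \<otimes>\<^bsub>G\<^esub> h) = \<rho> g * \<rho> h"
  by (simp add: is_rep_def)

lemma is_rep_dim: "is_rep G n \<rho> \<Longrightarrow> rep_dim G \<rho> = n"
  by (simp add: is_rep_def rep_dim_def)

context fin_group
begin

lemma is_rep_inv:
  assumes "is_rep G n \<rho>" "g \<in> carrier G"
  shows "\<rho> (inv g) * \<rho> g = 1\<^sub>m n" "\<rho> g * \<rho> (inv g) = 1\<^sub>m n"
  using assms is_rep_mult[OF assms(1), of "inv g" g] is_rep_mult[OF assms(1), of g "inv g"]
    is_rep_one[OF assms(1)] by auto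

text \<open>A homomorphism into the unit group maps \<open>\<one>\<close> to an invertible idempotent, hence to the
  identity matrix.\<close>

lemma group_rep_iff: "group_rep G \<rho> \<and> rep_dim G \<rho> = n \<longleftrightarrow> is_rep G n \<rho>"
proof
  assume *: "group_rep G \<rho> \<and> rep_dim G \<rho> = n"
  hence h: "\<rho> \<in> hom G (units_of (ring_mat TYPE(complex) n ()))"
    by (auto simp: group_rep_def)
  have U: "\<rho> g \<in> Units (ring_mat TYPE(complex) n ())" if "g \<in> carrier G" for g
    using h that by (auto simp: hom_def units_of_carrier Pi_iff)
  have c: "\<rho> g \<in> carrier_mat n n" if "g \<in> carrier G" for g
    using U[OF that] by (simp add: Units_ring_mat)
  have m: "\<rho> (g \<otimes> h) = \<rho> g * \<rho> h" if "g \<in> carrier G" "h \<in> carrier G" for g h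
    using h that by (simp add: hom_def units_of_mult ring_mat_simps)
  obtain Q where Q: "Q \<in> carrier_mat n n" "Q * \<rho> \<one> = 1\<^sub>m n"
    using U[of \<one>] by (auto simp: Units_ring_mat)
  have "\<rho> \<one> = Q * (\<rho> \<one> * \<rho> \<one>)"
    using Q c[of \<one>] by (simp add: assoc_mult_mat[OF Q(1) c c, symmetric])
  also have "\<rho> \<one> * \<rho> \<one> = \<rho> \<one>" using m[of \<one> \<one>] by simp
  finally have "\<rho> \<one> = 1\<^sub>m n" using Q by simp
  thus "is_rep G n \<rho>" using c m by (simp add: is_rep_def)
next
  assume r: "is_rep G n \<rho>"
  have d: "rep_dim G \<rho> = n" by (rule is_rep_dim[OF r])
  have "\<rho> g \<in> Units (ring_mat TYPE(complex) n ())" if g: "g \<in> carrier G" for g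
    unfolding Units_ring_mat using is_rep_carrier[OF r] is_rep_inv[OF r g] g by blast
  thus "group_rep G \<rho> \<and> rep_dim G \<rho> = n"
    using d is_rep_mult[OF r] by (simp add: group_rep_def hom_def units_of_carrier units_of_mult ring_mat_simps)
qed

lemma is_rep_group_rep: "is_rep G n \<rho> \<Longrightarrow> group_rep G \<rho>"
  using group_rep_iff by blast

lemma rep_isoI:
  assumes "is_rep G n \<rho>" "is_rep G n \<sigma>" "P \<in> carrier_mat n n" "Q \<in> carrier_mat n n"
    "Q * P = 1\<^sub>m n" "\<And>g. g \<in> carrier G \<Longrightarrow> P * \<rho> g = \<sigma> g * P"
  shows "rep_iso G \<rho> \<sigma>"
proof -
  have "P * Q = 1\<^sub>m n" by (rule mat_mult_left_right_inverse[OF assms(4,3,5)])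
  thus ?thesis
    unfolding rep_iso_def is_rep_dim[OF assms(1)] is_rep_dim[OF assms(2)] Bex_def Units_ring_mat
    using assms by blast
qed

lemma rep_isoE:
  assumes "rep_iso G \<rho> \<sigma>" "is_rep G n \<rho>"
  obtains P Q where "P \<in> carrier_mat n n" "Q \<in> carrier_mat n n" "Q * P = 1\<^sub>m n" "P * Q = 1\<^sub>m n"
    "\<And>g. g \<in> carrier G \<Longrightarrow> P * \<rho> g = \<sigma> g * P" "rep_dim G \<sigma> = n"
  using assms unfolding rep_iso_def is_rep_dim[OF assms(2)] Bex_def Units_ring_mat by metis

lemma rep_iso_refl:
  assumes "is_rep G n \<rho>"
  shows "rep_iso G \<rho> \<rho>"
  by (rule rep_isoI[OF assms assms, of "1\<^sub>m n" "1\<^sub>m n"])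
    (auto simp: left_mult_one_mat[OF is_rep_carrier[OF assms]] right_mult_one_mat[OF is_rep_carrier[OF assms]])

lemma rep_iso_sym:
  assumes "rep_iso G \<rho> \<sigma>" and r: "is_rep G n \<rho>" and s: "is_rep G n \<sigma>"
  shows "rep_iso G \<sigma> \<rho>"
proof -
  obtain P Q where P: "P \<in> carrier_mat n n" "Q \<in> carrier_mat n n" "Q * P = 1\<^sub>m n" "P * Q = 1\<^sub>m n"
    "\<And>g. g \<in> carrier G \<Longrightarrow> P * \<rho> g = \<sigma> g * P" using rep_isoE[OF assms(1,2)] by metis
  show ?thesis
  proof (rule rep_isoI[OF s r P(2,1,4)])
    fix g assume g: "g \<in> carrier G"
    note c = is_rep_carrier[OF r g] is_rep_carrier[OF s g]
    have "Q * \<sigma> g = Q * (\<sigma> g * P) * Q"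
      using P(1,2,4) c by (simp add: assoc_mult_mat[of Q n n "\<sigma> g * P" n Q n] assoc_mult_mat[of "\<sigma> g" n n P n Q n])
    also have "\<dots> = Q * (P * \<rho> g) * Q" using P(5)[OF g] by simp
    also have "\<dots> = \<rho> g * Q"
      using P(1,2,3) c by (simp add: assoc_mult_mat[of Q n n P n "\<rho> g" n, symmetric])
    finally show "Q * \<sigma> g = \<rho> g * Q" .
  qed
qed

lemma rep_iso_trans:
  assumes "rep_iso G \<rho> \<sigma>" "rep_iso G \<sigma> \<tau>" "is_rep G n \<rho>" "is_rep G n \<sigma>" "is_rep G n \<tau>"
  shows "rep_iso G \<rho> \<tau>"
proof -
  obtain P Q where P: "P \<in> carrier_mat n n" "Q \<in> carrier_mat n n" "Q * P = 1\<^sub>m n" "P * Q = 1\<^sub>m n"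
    "\<And>g. g \<in> carrier G \<Longrightarrow> P * \<rho> g = \<sigma> g * P" using rep_isoE[OF assms(1,3)] by metis
  obtain P' Q' where P': "P' \<in> carrier_mat n n" "Q' \<in> carrier_mat n n" "Q' * P' = 1\<^sub>m n" "P' * Q' = 1\<^sub>m n"
    "\<And>g. g \<in> carrier G \<Longrightarrow> P' * \<sigma> g = \<tau> g * P'" using rep_isoE[OF assms(2,4)] by metis
  show ?thesis
  proof (rule rep_isoI[OF assms(3,5), of "P' * P" "Q * Q'"])
    have "(Q * Q') * (P' * P) = Q * (Q' * (P' * P))"
      using P P' by (intro assoc_mult_mat[of _ n n _ n _ n]) auto
    also have "Q' * (P' * P) = (Q' * P') * P"
      using P P' by (intro assoc_mult_mat[of _ n n _ n _ n, symmetric]) auto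
    finally have "(Q * Q') * (P' * P) = Q * ((Q' * P') * P)" .
    thus "(Q * Q') * (P' * P) = 1\<^sub>m n" using P P' by simp
    fix g assume g: "g \<in> carrier G"
    note c = is_rep_carrier[OF assms(3) g] is_rep_carrier[OF assms(4) g] is_rep_carrier[OF assms(5) g]
    have "P' * P * \<rho> g = P' * (\<sigma> g * P)"
      using P P' c P(5)[OF g] by (simp add: assoc_mult_mat[of P' n n P n "\<rho> g" n])
    also have "\<dots> = (P' * \<sigma> g) * P"
      using P P' c by (simp add: assoc_mult_mat[of P' n n "\<sigma> g" n P n])
    also have "\<dots> = \<tau> g * (P' * P)"
      using P P' c P'(5)[OF g] by (simp add: assoc_mult_mat[of "\<tau> g" n n P' n P n])
    finally show "P' * P * \<rho> g = \<tau> g * (P' * P)" .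
  qed (use P P' in auto)
qed

lemma rep_iso_trace:
  assumes "rep_iso G \<rho> \<sigma>" "is_rep G n \<rho>" "is_rep G m \<sigma>" "g \<in> carrier G"
  shows "mat_trace (\<rho> g) = mat_trace (\<sigma> g)"
proof -
  obtain P Q where P: "P \<in> carrier_mat n n" "Q \<in> carrier_mat n n" "Q * P = 1\<^sub>m n"
    "P * \<rho> g = \<sigma> g * P" "m = n" using rep_isoE[OF assms(1,2)] assms(4) is_rep_dim[OF assms(3)] by metis
  show ?thesis
    by (rule mat_trace_similar[of _ n P Q])
      (use P assms is_rep_carrier[OF assms(2,4)] is_rep_carrier[OF assms(3,4)] in auto)
qed

end

subsection \<open>Direct sums and tensor products\<close>

definition rep_dsum :: "'a rep \<Rightarrow> 'a rep \<Rightarrow> 'a rep" where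
  "rep_dsum \<rho> \<sigma> = (\<lambda>g. four_block_mat (\<rho> g) (0\<^sub>m (dim_row (\<rho> g)) (dim_col (\<sigma> g)))
     (0\<^sub>m (dim_row (\<sigma> g)) (dim_col (\<rho> g))) (\<sigma> g))"

lemma rep_sum_Nil: "rep_sum [] = (\<lambda>g. 0\<^sub>m 0 0)"
  by (simp add: rep_sum_def)

lemma rep_sum_Cons: "rep_sum (\<rho> # \<rho>s) = rep_dsum \<rho> (rep_sum \<rho>s)"
  by (simp add: rep_sum_def rep_dsum_def Let_def)

lemma rep_sum_single: "rep_sum [\<rho>] = \<rho>"
  unfolding rep_sum_def list.map diag_block_mat_singleton ..

lemma rep_sum_append: "rep_sum (\<rho>s @ \<sigma>s) = rep_dsum (rep_sum \<rho>s) (rep_sum \<sigma>s)"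
  by (simp add: rep_sum_def rep_dsum_def Let_def diag_block_mat_append)

lemma rep_dsum_eq:
  assumes "is_rep G n \<rho>" "is_rep G m \<sigma>" "g \<in> carrier G"
  shows "rep_dsum \<rho> \<sigma> g = four_block_mat (\<rho> g) (0\<^sub>m n m) (0\<^sub>m m n) (\<sigma> g)"
  using is_rep_carrier[OF assms(1,3)] is_rep_carrier[OF assms(2,3)] by (simp add: rep_dsum_def)

lemma diag_four_block_mult:
  fixes A B C D :: "complex mat"
  assumes "A \<in> carrier_mat n1 n2" "B \<in> carrier_mat n2 n3" "C \<in> carrier_mat m1 m2" "D \<in> carrier_mat m2 m3"
  shows "four_block_mat A (0\<^sub>m n1 m2) (0\<^sub>m m1 n2) C * four_block_mat B (0\<^sub>m n2 m3) (0\<^sub>m m2 n3) D =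
    four_block_mat (A * B) (0\<^sub>m n1 m3) (0\<^sub>m m1 n3) (C * D)"
  using assms by (subst mult_four_block_mat[of _ n1 n2 _ m2 _ m1 _ _ n3 _ m3]) auto

context fin_group
begin

lemma is_rep_dsum:
  assumes r: "is_rep G n \<rho>" and s: "is_rep G m \<sigma>"
  shows "is_rep G (n + m) (rep_dsum \<rho> \<sigma>)"
  unfolding is_rep_def
proof (intro conjI ballI)
  fix g assume g: "g \<in> carrier G"
  show "rep_dsum \<rho> \<sigma> g \<in> carrier_mat (n + m) (n + m)"
    unfolding rep_dsum_eq[OF r s g] using is_rep_carrier[OF r g] is_rep_carrier[OF s g] by simp
  fix h assume h: "h \<in> carrier G"
  show "rep_dsum \<rho> \<sigma> (g \<otimes> h) = rep_dsum \<rho> \<sigma> g * rep_dsum \<rho> \<sigma> h"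
    unfolding rep_dsum_eq[OF r s g] rep_dsum_eq[OF r s h] rep_dsum_eq[OF r s m_closed[OF g h]]
      is_rep_mult[OF r g h] is_rep_mult[OF s g h]
    by (rule diag_four_block_mult[symmetric])
      (use is_rep_carrier[OF r g] is_rep_carrier[OF s g] is_rep_carrier[OF r h] is_rep_carrier[OF s h] in auto)
next
  show "rep_dsum \<rho> \<sigma> \<one> = 1\<^sub>m (n + m)"
    unfolding rep_dsum_eq[OF r s one_closed] is_rep_one[OF r] is_rep_one[OF s] by simp
qed

lemma is_rep_sum:
  assumes "\<And>\<rho>. \<rho> \<in> set \<rho>s \<Longrightarrow> is_rep G (d \<rho>) \<rho>"
  shows "is_rep G (sum_list (map d \<rho>s)) (rep_sum \<rho>s)"
  using assms
proof (induct \<rho>s)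
  case Nil
  show ?case by (auto simp: is_rep_def rep_sum_Nil)
next
  case (Cons \<rho> \<rho>s)
  show ?case using is_rep_dsum[of "d \<rho>" \<rho> "sum_list (map d \<rho>s)" "rep_sum \<rho>s"] Cons
    by (simp add: rep_sum_Cons)
qed

lemma trace_dsum:
  assumes "is_rep G n \<rho>" "is_rep G m \<sigma>" "g \<in> carrier G"
  shows "mat_trace (rep_dsum \<rho> \<sigma> g) = mat_trace (\<rho> g) + mat_trace (\<sigma> g)"
  unfolding rep_dsum_eq[OF assms]
  by (rule mat_trace_four_block[OF is_rep_carrier[OF assms(1,3)] is_rep_carrier[OF assms(2,3)]])

lemma trace_rep_sum:
  assumes "\<And>\<rho>. \<rho> \<in> set \<rho>s \<Longrightarrow> is_rep G (d \<rho>) \<rho>" "g \<in> carrier G"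
  shows "mat_trace (rep_sum \<rho>s g) = (\<Sum>\<rho>\<leftarrow>\<rho>s. mat_trace (\<rho> g))"
  using assms(1)
proof (induct \<rho>s)
  case Nil
  show ?case by (simp add: rep_sum_Nil mat_trace_def)
next
  case (Cons \<rho> \<rho>s)
  show ?case using trace_dsum[of "d \<rho>" \<rho> "sum_list (map d \<rho>s)" "rep_sum \<rho>s" g]
      is_rep_sum[of \<rho>s d] Cons assms(2)
    by (simp add: rep_sum_Cons)
qed

lemma rep_iso_dsum:
  assumes "rep_iso G \<rho> \<rho>'" "rep_iso G \<sigma> \<sigma>'"
    and r: "is_rep G n \<rho>" and r': "is_rep G n \<rho>'" and s: "is_rep G m \<sigma>" and s': "is_rep G m \<sigma>'"
  shows "rep_iso G (rep_dsum \<rho> \<sigma>) (rep_dsum \<rho>' \<sigma>')"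
proof -
  obtain P Q where P: "P \<in> carrier_mat n n" "Q \<in> carrier_mat n n" "Q * P = 1\<^sub>m n" "P * Q = 1\<^sub>m n"
    "\<And>g. g \<in> carrier G \<Longrightarrow> P * \<rho> g = \<rho>' g * P" using rep_isoE[OF assms(1) r] by metis
  obtain P' Q' where P': "P' \<in> carrier_mat m m" "Q' \<in> carrier_mat m m" "Q' * P' = 1\<^sub>m m" "P' * Q' = 1\<^sub>m m"
    "\<And>g. g \<in> carrier G \<Longrightarrow> P' * \<sigma> g = \<sigma>' g * P'" using rep_isoE[OF assms(2) s] by metis
  let ?D = "\<lambda>A B. four_block_mat A (0\<^sub>m n m) (0\<^sub>m m n) B"
  show ?thesis
  proof (rule rep_isoI[OF is_rep_dsum[OF r s] is_rep_dsum[OF r' s'], of "?D P P'" "?D Q Q'"])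
    show "?D Q Q' * ?D P P' = 1\<^sub>m (n + m)"
      using diag_four_block_mult[OF P(2,1) P'(2,1)] P(3) P'(3) by simp
    fix g assume g: "g \<in> carrier G"
    show "?D P P' * rep_dsum \<rho> \<sigma> g = rep_dsum \<rho>' \<sigma>' g * ?D P P'"
      unfolding rep_dsum_eq[OF r s g] rep_dsum_eq[OF r' s' g]
      using diag_four_block_mult[OF P(1) is_rep_carrier[OF r g] P'(1) is_rep_carrier[OF s g]]
        diag_four_block_mult[OF is_rep_carrier[OF r' g] P(1) is_rep_carrier[OF s' g] P'(1)]
        P(5)[OF g] P'(5)[OF g] by simp
  qed (use P P' in auto)
qed

text \<open>The two blocks are exchanged by the block permutation matrix.\<close>

lemma rep_iso_dsum_comm:
  assumes r: "is_rep G n \<rho>" and s: "is_rep G m \<sigma>"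
  shows "rep_iso G (rep_dsum \<rho> \<sigma>) (rep_dsum \<sigma> \<rho>)"
proof -
  have s': "is_rep G (n + m) (rep_dsum \<sigma> \<rho>)" using is_rep_dsum[OF s r] by (simp add: add.commute)
  let ?P = "four_block_mat (0\<^sub>m m n) (1\<^sub>m m) (1\<^sub>m n) (0\<^sub>m n m) :: complex mat"
  let ?Q = "four_block_mat (0\<^sub>m n m) (1\<^sub>m n) (1\<^sub>m m) (0\<^sub>m m n) :: complex mat"
  show ?thesis
  proof (rule rep_isoI[OF is_rep_dsum[OF r s] s', of ?P ?Q])
    have "?P \<in> carrier_mat (m + n) (n + m)" "?Q \<in> carrier_mat (n + m) (m + n)"
      by (rule four_block_carrier_mat; simp)+
    thus "?P \<in> carrier_mat (n + m) (n + m)" "?Q \<in> carrier_mat (n + m) (n + m)"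
      by (simp_all add: add.commute)
    show "?Q * ?P = 1\<^sub>m (n + m)"
      by (subst mult_four_block_mat[of _ n m _ n _ m _ _ n _ m]) auto
    fix g assume g: "g \<in> carrier G"
    show "?P * rep_dsum \<rho> \<sigma> g = rep_dsum \<sigma> \<rho> g * ?P"
      unfolding rep_dsum_eq[OF r s g] rep_dsum_eq[OF s r g]
      using is_rep_carrier[OF r g] is_rep_carrier[OF s g]
      by (subst mult_four_block_mat[of _ m n _ m _ n _ _ n _ m], simp_all)
        (subst mult_four_block_mat[of _ m m _ n _ n _ _ n _ m], simp_all)
  qed
qed

lemma is_rep_tensor:
  assumes r: "is_rep G n \<rho>" and s: "is_rep G m \<sigma>"
  shows "is_rep G (n * m) (rep_tensor \<rho> \<sigma>)"
  unfolding is_rep_def rep_tensor_def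
proof (intro conjI ballI)
  fix g assume g: "g \<in> carrier G"
  show "kronecker_mat (\<rho> g) (\<sigma> g) \<in> carrier_mat (n * m) (n * m)"
    by (rule kronecker_carrier[OF is_rep_carrier[OF r g] is_rep_carrier[OF s g]])
  fix h assume h: "h \<in> carrier G"
  show "kronecker_mat (\<rho> (g \<otimes> h)) (\<sigma> (g \<otimes> h)) = kronecker_mat (\<rho> g) (\<sigma> g) * kronecker_mat (\<rho> h) (\<sigma> h)"
    unfolding is_rep_mult[OF r g h] is_rep_mult[OF s g h]
    by (rule kronecker_mult[OF is_rep_carrier[OF r g] is_rep_carrier[OF s g]
          is_rep_carrier[OF r h] is_rep_carrier[OF s h], symmetric])
next
  have [simp]: "1 \<cdot>\<^sub>m 1\<^sub>m k = (1\<^sub>m k :: complex mat)" for k by (rule eq_matI) auto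
  show "kronecker_mat (\<rho> \<one>) (\<sigma> \<one>) = 1\<^sub>m (n * m)"
    unfolding is_rep_one[OF r] is_rep_one[OF s]
    using kronecker_smult_one[of 1 n 1 m] by simp
qed

lemma trace_tensor:
  assumes "is_rep G n \<rho>" "is_rep G m \<sigma>" "g \<in> carrier G"
  shows "mat_trace (rep_tensor \<rho> \<sigma> g) = mat_trace (\<rho> g) * mat_trace (\<sigma> g)"
  unfolding rep_tensor_def
  by (rule mat_trace_kronecker[OF is_rep_carrier[OF assms(1,3)] is_rep_carrier[OF assms(2,3)]])

end

section \<open>Complete reducibility\<close>

definition vsub :: "nat \<Rightarrow> complex vec set \<Rightarrow> bool" where
  "vsub n W \<longleftrightarrow> W \<subseteq> carrier_vec n \<and> 0\<^sub>v n \<in> W \<and> (\<forall>v\<in>W. \<forall>w\<in>W. v + w \<in> W) \<and>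
     (\<forall>c. \<forall>v\<in>W. c \<cdot>\<^sub>v v \<in> W)"

lemma subspace_iff_vsub:
  "VectorSpace.subspace class_ring W (module_vec TYPE(complex) n) \<longleftrightarrow> vsub n W"
  using vec_module[where 'a = complex, of n] vec_vs[where 'a = complex, of n]
  by (auto simp: VectorSpace.subspace_def submodule_def vsub_def module_vec_simps)

lemma mult_vec_index_sum:
  assumes "A \<in> carrier_mat n m" "v \<in> carrier_vec m" "i < n"
  shows "(A *\<^sub>v v) $ i = (\<Sum>j<m. A $$ (i, j) * v $ j)"
  using assms by (simp add: scalar_prod_def atLeast0LessThan)

lemma vsub_lincomb:
  assumes W: "vsub n W" and J: "J \<in> carrier_mat n m" and c: "c \<in> carrier_vec m"
    and cols: "\<And>j. j < m \<Longrightarrow> col J j \<in> W"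
  shows "J *\<^sub>v c \<in> W"
proof -
  have "vec n (\<lambda>i. \<Sum>j<k. J $$ (i, j) * c $ j) \<in> W" if "k \<le> m" for k
    using that
  proof (induct k)
    case 0
    have "vec n (\<lambda>i. 0) = (0\<^sub>v n :: complex vec)" by auto
    thus ?case using W by (simp add: vsub_def)
  next
    case (Suc k)
    have "vec n (\<lambda>i. \<Sum>j<Suc k. J $$ (i, j) * c $ j) =
        vec n (\<lambda>i. \<Sum>j<k. J $$ (i, j) * c $ j) + (c $ k) \<cdot>\<^sub>v col J k"
      using J Suc.prems by (intro eq_vecI) (auto simp: mult.commute)
    thus ?case using Suc W cols[of k] by (auto simp: vsub_def)
  qed
  moreover have "J *\<^sub>v c = vec n (\<lambda>i. \<Sum>j<m. J $$ (i, j) * c $ j)"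
    using J c by (intro eq_vecI) (auto simp: scalar_prod_def atLeast0LessThan)
  ultimately show ?thesis by simp
qed

text \<open>Given linearly independent columns in \<open>W\<close>, in the form of a matrix \<open>J\<close> with a left inverse
  \<open>L\<close>, the map \<open>J * L\<close> is a projection onto their span. If it moves \<open>w \<in> W\<close>, then
  \<open>u = w - J * L * w\<close> is a nonzero element of \<open>W\<close> killed by \<open>L\<close> and becomes the new column. The new
  row of the left inverse is the row \<open>k\<close> of \<open>1 - J * L\<close> divided by \<open>u $ k \<noteq> 0\<close>.\<close>

lemma left_inverse_extend_step:
  fixes J L :: "complex mat"
  assumes W: "vsub n W" and J: "J \<in> carrier_mat n m" and L: "L \<in> carrier_mat m n" and LJ: "L * J = 1\<^sub>m m"
    and cols: "\<And>j. j < m \<Longrightarrow> col J j \<in> W"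
    and w: "w \<in> W" "J *\<^sub>v (L *\<^sub>v w) \<noteq> w"
  shows "\<exists>J' L'. J' \<in> carrier_mat n (Suc m) \<and> L' \<in> carrier_mat (Suc m) n \<and> L' * J' = 1\<^sub>m (Suc m) \<and>
    (\<forall>j<m. col J' j = col J j) \<and> (\<forall>j<Suc m. col J' j \<in> W)"
proof -
  have wc: "w \<in> carrier_vec n" using W w by (auto simp: vsub_def)
  have Lw: "L *\<^sub>v w \<in> carrier_vec m" using L wc by simp
  have JLw: "J *\<^sub>v (L *\<^sub>v w) \<in> carrier_vec n" using J Lw by simp
  define u where "u = w + (-1) \<cdot>\<^sub>v (J *\<^sub>v (L *\<^sub>v w))"
  have "J *\<^sub>v (L *\<^sub>v w) \<in> W" by (rule vsub_lincomb[OF W J Lw cols])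
  hence uW: "u \<in> W" using W w by (auto simp: vsub_def u_def)
  have uc: "u \<in> carrier_vec n" using W uW by (auto simp: vsub_def)
  have Lu: "L *\<^sub>v u = 0\<^sub>v m"
  proof -
    have "L *\<^sub>v u = L *\<^sub>v w + (-1) \<cdot>\<^sub>v (L *\<^sub>v (J *\<^sub>v (L *\<^sub>v w)))"
      unfolding u_def using L wc JLw
      by (simp add: mult_add_distrib_mat_vec[of L m n] mult_mat_vec[of L m n])
    also have "L *\<^sub>v (J *\<^sub>v (L *\<^sub>v w)) = L *\<^sub>v w"
      using assoc_mult_mat_vec[OF L J Lw, symmetric] LJ Lw by simp
    finally show ?thesis using Lw L by (intro eq_vecI) (auto simp del: index_mult_mat_vec)
  qed
  have "\<exists>k<n. u $ k \<noteq> 0"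
  proof (rule ccontr)
    assume *: "\<not> ?thesis"
    have "J *\<^sub>v (L *\<^sub>v w) = w"
    proof (rule eq_vecI)
      fix i assume i: "i < dim_vec w"
      hence "u $ i = 0" using * wc by auto
      thus "(J *\<^sub>v (L *\<^sub>v w)) $ i = w $ i" using i J wc JLw by (simp add: u_def)
    qed (use J wc in auto)
    thus False using w by simp
  qed
  then obtain k where k: "k < n" "u $ k \<noteq> 0" by blast
  define J' where "J' = mat n (Suc m) (\<lambda>(i, j). if j < m then J $$ (i, j) else u $ i)"
  define L' where "L' = mat (Suc m) n (\<lambda>(i, l). if i < m then L $$ (i, l)
    else ((if l = k then 1 else 0) - (J * L) $$ (k, l)) / u $ k)"
  have c: "J' \<in> carrier_mat n (Suc m)" "L' \<in> carrier_mat (Suc m) n" by (auto simp: J'_def L'_def)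
  have JL: "J * L \<in> carrier_mat n n" using J L by simp
  have last_row: "(\<Sum>l<n. ((if l = k then 1 else 0) - (J * L) $$ (k, l)) / u $ k * x l) =
      (x k - (\<Sum>l<n. (J * L) $$ (k, l) * x l)) / u $ k" for x
  proof -
    have "(\<Sum>l<n. ((if l = k then 1 else 0) - (J * L) $$ (k, l)) / u $ k * x l) =
        (\<Sum>l<n. ((if l = k then x l else 0) - (J * L) $$ (k, l) * x l) / u $ k)"
      by (intro sum.cong) (auto simp: field_simps)
    thus ?thesis using k by (simp add: sum_divide_distrib[symmetric] sum_subtractf)
  qed
  have "L' * J' = 1\<^sub>m (Suc m)"
  proof (rule eq_matI)
    fix i j assume "i < dim_row (1\<^sub>m (Suc m) :: complex mat)" "j < dim_col (1\<^sub>m (Suc m) :: complex mat)"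
    hence ij: "i < Suc m" "j < Suc m" by auto
    have e: "(L' * J') $$ (i, j) = (\<Sum>l<n. L' $$ (i, l) * J' $$ (l, j))"
      by (rule mult_index_sum[OF c(2,1) ij])
    consider "i < m" "j < m" | "i < m" "j = m" | "i = m" "j < m" | "i = m" "j = m"
      using ij by linarith
    thus "(L' * J') $$ (i, j) = 1\<^sub>m (Suc m) $$ (i, j)"
    proof cases
      case 1
      have "(L' * J') $$ (i, j) = (\<Sum>l<n. L $$ (i, l) * J $$ (l, j))"
        unfolding e using 1 by (intro sum.cong) (auto simp: L'_def J'_def)
      also have "\<dots> = (L * J) $$ (i, j)" using mult_index_sum[OF L J] 1 by simp
      finally show ?thesis using 1 LJ by simp
    next
      case 2
      have "(L' * J') $$ (i, j) = (\<Sum>l<n. L $$ (i, l) * u $ l)"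
        unfolding e using 2 by (intro sum.cong) (auto simp: L'_def J'_def)
      also have "\<dots> = (L *\<^sub>v u) $ i" using 2 L uc by (simp add: scalar_prod_def atLeast0LessThan)
      finally show ?thesis using 2 Lu by simp
    next
      case 3
      have "(L' * J') $$ (i, j) = (\<Sum>l<n. ((if l = k then 1 else 0) - (J * L) $$ (k, l)) / u $ k * J $$ (l, j))"
        unfolding e using 3 by (intro sum.cong) (auto simp: L'_def J'_def)
      also have "\<dots> = (J $$ (k, j) - (J * L * J) $$ (k, j)) / u $ k"
        unfolding last_row using mult_index_sum[OF JL J k(1) 3(2)] by simp
      also have "J * L * J = J" using assoc_mult_mat[OF J L J] LJ J by simp
      finally show ?thesis using 3 by simp
    next
      case 4
      have "(L' * J') $$ (i, j) = (\<Sum>l<n. ((if l = k then 1 else 0) - (J * L) $$ (k, l)) / u $ k * u $ l)"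
        unfolding e using 4 by (intro sum.cong) (auto simp: L'_def J'_def)
      also have "\<dots> = (u $ k - ((J * L) *\<^sub>v u) $ k) / u $ k"
        unfolding last_row using k JL uc by (simp add: scalar_prod_def atLeast0LessThan del: index_mult_mat)
      also have "(J * L) *\<^sub>v u = 0\<^sub>v n" using assoc_mult_mat_vec[OF J L uc] Lu J by auto
      finally show ?thesis using 4 k by simp
    qed
  qed (use c in auto)
  moreover have "col J' j = col J j" if "j < m" for j
    using that J by (intro eq_vecI) (auto simp: J'_def)
  moreover have "col J' m = u" using uc by (intro eq_vecI) (auto simp: J'_def)
  ultimately show ?thesis using c cols uW by (metis less_Suc_eq)
qed

text \<open>Iterating the extension ends because a left invertible \<open>n \<times> m\<close> matrix has \<open>m \<le> n\<close>. Started with no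
  columns this produces a basis of \<open>W\<close>; started with such a basis and with the whole space in place
  of \<open>W\<close> it produces a basis of the space adapted to \<open>W\<close>.\<close>

lemma left_inverse_extend:
  fixes J L :: "complex mat"
  assumes W: "vsub n W" and "J \<in> carrier_mat n m" "L \<in> carrier_mat m n" "L * J = 1\<^sub>m m"
    and "\<And>j. j < m \<Longrightarrow> col J j \<in> W"
  shows "\<exists>m' J' L'. m \<le> m' \<and> J' \<in> carrier_mat n m' \<and> L' \<in> carrier_mat m' n \<and> L' * J' = 1\<^sub>m m' \<and>
    (\<forall>j<m. col J' j = col J j) \<and> (\<forall>j<m'. col J' j \<in> W) \<and> (\<forall>w\<in>W. J' *\<^sub>v (L' *\<^sub>v w) = w)"
  using assms(2-)
proof (induct "n - m" arbitrary: m J L rule: less_induct)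
  case less
  show ?case
  proof (cases "\<forall>w\<in>W. J *\<^sub>v (L *\<^sub>v w) = w")
    case True
    thus ?thesis using less.prems by blast
  next
    case False
    then obtain w where w: "w \<in> W" "J *\<^sub>v (L *\<^sub>v w) \<noteq> w" by blast
    obtain J1 L1 where 1: "J1 \<in> carrier_mat n (Suc m)" "L1 \<in> carrier_mat (Suc m) n" "L1 * J1 = 1\<^sub>m (Suc m)"
      "\<forall>j<m. col J1 j = col J j" "\<forall>j<Suc m. col J1 j \<in> W"
      using left_inverse_extend_step[OF W less.prems(1-3) less.prems(4) w] by blast
    have "Suc m \<le> n" by (rule left_invertible_le[OF 1(1-3)])
    hence "n - Suc m < n - m" by simp
    from less.hyps[OF this 1(1-3)] 1(5) obtain m' J' L' where
      "Suc m \<le> m'" "J' \<in> carrier_mat n m'" "L' \<in> carrier_mat m' n" "L' * J' = 1\<^sub>m m'"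
      "\<forall>j<Suc m. col J' j = col J1 j" "\<forall>j<m'. col J' j \<in> W" "\<forall>w\<in>W. J' *\<^sub>v (L' *\<^sub>v w) = w"
      by blast
    with 1(4) show ?thesis by (intro exI[of _ m'] exI[of _ J'] exI[of _ L']) auto
  qed
qed

lemma smult_add_index:
  fixes A B :: "complex mat"
  assumes "A \<in> carrier_mat n m" "B \<in> carrier_mat n m" "i < n" "j < m"
  shows "(c \<cdot>\<^sub>m (A + B)) $$ (i, j) = c * A $$ (i, j) + c * B $$ (i, j)"
  using assms by (simp add: distrib_left)

lemma eq_mat_by_mult_vec:
  fixes A B :: "complex mat"
  assumes "A \<in> carrier_mat n m" "B \<in> carrier_mat n m" "\<And>v. v \<in> carrier_vec m \<Longrightarrow> A *\<^sub>v v = B *\<^sub>v v"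
  shows "A = B"
proof (rule eq_matI)
  fix i j assume "i < dim_row B" "j < dim_col B"
  hence ij: "i < n" "j < m" using assms by auto
  have "(A *\<^sub>v unit_vec m j) $ i = (B *\<^sub>v unit_vec m j) $ i" using assms(3) by simp
  thus "A $$ (i, j) = B $$ (i, j)" using assms(1,2) ij by simp
qed (use assms in auto)

text \<open>In a basis \<open>P\<close> whose first \<open>m\<close> vectors span \<open>W\<close>, every endomorphism preserving \<open>W\<close> is block upper
  triangular with a diagonal block of size \<open>m\<close>.\<close>

lemma vsub_adapted_basis:
  assumes W: "vsub n W" and W0: "W \<noteq> {0\<^sub>v n}" and W1: "W \<noteq> carrier_vec n"
  shows "\<exists>m k P Q. 0 < m \<and> 0 < k \<and> m + k = n \<and> P \<in> carrier_mat n n \<and> Q \<in> carrier_mat n n \<and>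
    Q * P = 1\<^sub>m n \<and> P * Q = 1\<^sub>m n \<and>
    (\<forall>A\<in>carrier_mat n n. (\<forall>w\<in>W. A *\<^sub>v w \<in> W) \<longrightarrow>
      (\<forall>i<n. \<forall>j<m. m \<le> i \<longrightarrow> (Q * A * P) $$ (i, j) = 0))"
proof -
  have "(0\<^sub>m 0 n :: complex mat) * 0\<^sub>m n 0 = 1\<^sub>m 0" by (rule eq_matI) auto
  from left_inverse_extend[OF W _ _ this] obtain m J L where
    J: "J \<in> carrier_mat n m" and L: "L \<in> carrier_mat m n" and LJ: "L * J = 1\<^sub>m m"
    and cols: "\<And>j. j < m \<Longrightarrow> col J j \<in> W" and fix_W: "\<And>w. w \<in> W \<Longrightarrow> J *\<^sub>v (L *\<^sub>v w) = w"
    by auto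
  have "vsub n (carrier_vec n)" by (auto simp: vsub_def)
  from left_inverse_extend[OF this J L LJ] J obtain n' P Q where
    mn': "m \<le> n'" and P: "P \<in> carrier_mat n n'" and Q: "Q \<in> carrier_mat n' n" and QP: "Q * P = 1\<^sub>m n'"
    and colsP: "\<And>j. j < m \<Longrightarrow> col P j = col J j" and id: "\<And>v. v \<in> carrier_vec n \<Longrightarrow> P *\<^sub>v (Q *\<^sub>v v) = v"
    by auto
  have PQ: "P * Q = 1\<^sub>m n"
    by (rule eq_mat_by_mult_vec[of _ n n]) (use P Q id in \<open>auto simp: assoc_mult_mat_vec[OF P Q]\<close>)
  have n': "n' = n" using two_sided_inverse_square[OF P Q PQ QP] by simp
  have Wc: "W \<subseteq> carrier_vec n" using W by (simp add: vsub_def)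
  have "m \<noteq> 0"
  proof
    assume "m = 0"
    have "w = 0\<^sub>v n" if "w \<in> W" for w
    proof -
      have "J *\<^sub>v (L *\<^sub>v w) = 0\<^sub>v n"
        using J L \<open>m = 0\<close> by (intro eq_vecI) (auto simp: scalar_prod_def)
      thus ?thesis using fix_W[OF that] by simp
    qed
    moreover have "0\<^sub>v n \<in> W" using W by (simp add: vsub_def)
    ultimately show False using W0 by blast
  qed
  moreover have "m \<noteq> n"
  proof
    assume mn: "m = n"
    have "J * L = 1\<^sub>m n" by (rule mat_mult_left_right_inverse) (use L J LJ mn in auto)
    hence "v \<in> W" if v: "v \<in> carrier_vec n" for v
      using vsub_lincomb[OF W J _ cols, of "L *\<^sub>v v"] assoc_mult_mat_vec[OF J L v] L v by simp
    thus False using W1 Wc by blast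
  qed
  moreover have "(Q * A * P) $$ (i, j) = 0"
    if A: "A \<in> carrier_mat n n" and inv: "\<forall>w\<in>W. A *\<^sub>v w \<in> W" and ij: "i < n" "j < m" "m \<le> i" for A i j
  proof -
    have jn: "j < n" using ij by simp
    have QJ: "Q * J \<in> carrier_mat n m" using Q J n' by simp
    have QJ0: "(Q * J) $$ (i, l) = 0" if l: "l < m" for l
    proof -
      have "(Q * J) $$ (i, l) = row Q i \<bullet> col J l" using Q J ij l n' by simp
      also have "\<dots> = (Q * P) $$ (i, l)" using Q P ij l n' mn' colsP[OF l] by simp
      also have "\<dots> = 0" using QP ij l n' by simp
      finally show ?thesis .
    qed
    define c where "c = L *\<^sub>v (A *\<^sub>v col P j)"
    have "A *\<^sub>v col P j \<in> W" using inv cols[OF ij(2)] colsP[OF ij(2)] by simp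
    from fix_W[OF this] have w: "A *\<^sub>v col P j = J *\<^sub>v c" by (simp add: c_def)
    have cc: "c \<in> carrier_vec m" unfolding c_def using L by (intro carrier_vecI) auto
    have "(Q * A * P) $$ (i, j) = (Q * A * P *\<^sub>v unit_vec n j) $ i"
      using Q A P n' ij jn by simp
    also have "Q * A * P *\<^sub>v unit_vec n j = Q *\<^sub>v (A *\<^sub>v (P *\<^sub>v unit_vec n j))"
      using Q A P n' by (simp add: assoc_mult_mat_vec[of _ n n _ n])
    also have "P *\<^sub>v unit_vec n j = col P j" using P n' jn by (intro eq_vecI) auto
    also have "Q *\<^sub>v (A *\<^sub>v col P j) = (Q * J) *\<^sub>v c"
      unfolding w using assoc_mult_mat_vec[OF Q J cc] by simp
    also have "((Q * J) *\<^sub>v c) $ i = (\<Sum>l<m. (Q * J) $$ (i, l) * c $ l)"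
      by (rule mult_vec_index_sum[OF QJ cc ij(1)])
    also have "\<dots> = 0" using QJ0 by simp
    finally show ?thesis .
  qed
  moreover have "m \<le> n" using mn' n' by simp
  ultimately show ?thesis using P Q PQ QP n'
    by (intro exI[of _ m] exI[of _ "n - m"] exI[of _ P] exI[of _ Q]) auto
qed

lemma four_block_inject:
  fixes A B C D A' B' C' D' :: "complex mat"
  assumes "four_block_mat A B C D = four_block_mat A' B' C' D'"
    and "A \<in> carrier_mat m m" "B \<in> carrier_mat m k" "C \<in> carrier_mat k m" "D \<in> carrier_mat k k"
    and "A' \<in> carrier_mat m m" "B' \<in> carrier_mat m k" "C' \<in> carrier_mat k m" "D' \<in> carrier_mat k k"
  shows "A = A'" "B = B'" "C = C'" "D = D'"
proof -
  have e: "four_block_mat A B C D $$ ij = four_block_mat A' B' C' D' $$ ij" for ij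
    using assms(1) by simp
  show "A = A'"
  proof (rule eq_matI)
    fix i j assume "i < dim_row A'" "j < dim_col A'"
    thus "A $$ (i, j) = A' $$ (i, j)" using e[of "(i, j)"] assms(2-) by auto
  qed (use assms(2-) in auto)
  show "B = B'"
  proof (rule eq_matI)
    fix i j assume "i < dim_row B'" "j < dim_col B'"
    thus "B $$ (i, j) = B' $$ (i, j)" using e[of "(i, m + j)"] assms(2-) by auto
  qed (use assms(2-) in auto)
  show "C = C'"
  proof (rule eq_matI)
    fix i j assume "i < dim_row C'" "j < dim_col C'"
    thus "C $$ (i, j) = C' $$ (i, j)" using e[of "(m + i, j)"] assms(2-) by auto
  qed (use assms(2-) in auto)
  show "D = D'"
  proof (rule eq_matI)
    fix i j assume "i < dim_row D'" "j < dim_col D'"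
    thus "D $$ (i, j) = D' $$ (i, j)" using e[of "(m + i, m + j)"] assms(2-) by auto
  qed (use assms(2-) in auto)
qed

context fin_group
begin

lemma card_carrier_nonzero: "(of_nat (card (carrier G)) :: complex) \<noteq> 0"
  using fin one_closed by (metis card_eq_0_iff empty_iff of_nat_eq_0_iff)

text \<open>For a block triangular representation with diagonal blocks \<open>A\<close>, \<open>D\<close> and corner \<open>B\<close>,
  multiplicativity gives \<open>B (g \<otimes> h) = A g * B h + B g * D h\<close>. The mean \<open>X\<close> of \<open>A g * B (inv g)\<close> over
  the group then satisfies \<open>A h * X = B h + X * D h\<close>, which says that conjugation by the unipotent
  block matrix with corner \<open>X\<close> removes \<open>B\<close>.\<close>

lemma maschke:
  assumes r: "is_rep G (m + k) \<rho>"
    and blk: "\<And>g. g \<in> carrier G \<Longrightarrow> \<rho> g = four_block_mat (A g) (B g) (0\<^sub>m k m) (D g)"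
    and A: "\<And>g. g \<in> carrier G \<Longrightarrow> A g \<in> carrier_mat m m"
    and B: "\<And>g. g \<in> carrier G \<Longrightarrow> B g \<in> carrier_mat m k"
    and D: "\<And>g. g \<in> carrier G \<Longrightarrow> D g \<in> carrier_mat k k"
  shows "is_rep G m A" "is_rep G k D" "rep_iso G \<rho> (rep_dsum A D)"
proof -
  have mult: "A (g \<otimes> h) = A g * A h" "B (g \<otimes> h) = A g * B h + B g * D h" "D (g \<otimes> h) = D g * D h"
    if g: "g \<in> carrier G" and h: "h \<in> carrier G" for g h
  proof -
    have "four_block_mat (A (g \<otimes> h)) (B (g \<otimes> h)) (0\<^sub>m k m) (D (g \<otimes> h)) =
        four_block_mat (A g) (B g) (0\<^sub>m k m) (D g) * four_block_mat (A h) (B h) (0\<^sub>m k m) (D h)"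
      using is_rep_mult[OF r g h] blk g h by simp
    also have "\<dots> = four_block_mat (A g * A h) (A g * B h + B g * D h) (0\<^sub>m k m) (D g * D h)"
      using A[OF g] A[OF h] B[OF g] B[OF h] D[OF g] D[OF h]
      by (subst mult_four_block_mat[of _ m m _ k _ k _ _ m _ k]) auto
    finally have e: "four_block_mat (A (g \<otimes> h)) (B (g \<otimes> h)) (0\<^sub>m k m) (D (g \<otimes> h)) =
      four_block_mat (A g * A h) (A g * B h + B g * D h) (0\<^sub>m k m) (D g * D h)" .
    have c: "g \<otimes> h \<in> carrier G" using g h by simp
    note i = four_block_inject[OF e A[OF c] B[OF c] zero_carrier_mat D[OF c]]
    show "A (g \<otimes> h) = A g * A h" "B (g \<otimes> h) = A g * B h + B g * D h" "D (g \<otimes> h) = D g * D h"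
      using i A[OF g] A[OF h] B[OF g] B[OF h] D[OF g] D[OF h] by auto
  qed
  have e1: "four_block_mat (A \<one>) (B \<one>) (0\<^sub>m k m) (D \<one>) =
      four_block_mat (1\<^sub>m m) (0\<^sub>m m k) (0\<^sub>m k m) (1\<^sub>m k)"
    using blk[OF one_closed] is_rep_one[OF r] by simp
  note one = four_block_inject[OF e1 A[OF one_closed] B[OF one_closed] zero_carrier_mat D[OF one_closed]
      one_carrier_mat zero_carrier_mat zero_carrier_mat one_carrier_mat]
  show rA: "is_rep G m A" and rD: "is_rep G k D"
    unfolding is_rep_def using A D mult one by auto
  define c where "c = 1 / (of_nat (card (carrier G)) :: complex)"
  have cN: "(\<Sum>x\<in>carrier G. c * b) = b" for b :: complex
    using card_carrier_nonzero by (simp add: c_def)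
  define X where "X = mat_sum (carrier G) (\<lambda>g. c \<cdot>\<^sub>m (A g * B (inv g))) m k"
  have Xc: "X \<in> carrier_mat m k" by (simp add: X_def)
  have key: "A h * X = B h + X * D h" if h: "h \<in> carrier G" for h
  proof -
    have bij: "bij_betw (\<lambda>x. inv h \<otimes> x) (carrier G) (carrier G)"
      by (rule bij_betw_byWitness[where f' = "\<lambda>x. h \<otimes> x"])
        (use h in \<open>auto simp: m_assoc[symmetric]\<close>)
    have step: "A h * (c \<cdot>\<^sub>m (A (inv h \<otimes> x) * B (inv (inv h \<otimes> x)))) =
        c \<cdot>\<^sub>m (B h + A x * B (inv x) * D h)" if x: "x \<in> carrier G" for x
    proof -
      have cl: "inv h \<otimes> x \<in> carrier G" "inv x \<in> carrier G" "inv x \<otimes> h \<in> carrier G" using x h by auto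
      have iv: "inv (inv h \<otimes> x) = inv x \<otimes> h" using x h by (simp add: inv_mult_group)
      have "A h * (c \<cdot>\<^sub>m (A (inv h \<otimes> x) * B (inv x \<otimes> h))) = c \<cdot>\<^sub>m (A h * (A (inv h \<otimes> x) * B (inv x \<otimes> h)))"
        by (rule mult_smult_distrib[OF A[OF h] mult_carrier_mat[OF A[OF cl(1)] B[OF cl(3)]]])
      also have "A h * (A (inv h \<otimes> x) * B (inv x \<otimes> h)) = A h * A (inv h \<otimes> x) * B (inv x \<otimes> h)"
        by (rule assoc_mult_mat[OF A[OF h] A[OF cl(1)] B[OF cl(3)], symmetric])
      also have "A h * A (inv h \<otimes> x) = A x"
        using mult(1)[OF h cl(1)] h x by (simp add: m_assoc[symmetric])
      also have "A x * B (inv x \<otimes> h) = A x * (A (inv x) * B h) + A x * (B (inv x) * D h)"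
        unfolding mult(2)[OF cl(2) h]
        by (rule mult_add_distrib_mat[OF A[OF x] mult_carrier_mat[OF A[OF cl(2)] B[OF h]]
              mult_carrier_mat[OF B[OF cl(2)] D[OF h]]])
      also have "A x * (A (inv x) * B h) = B h"
        unfolding assoc_mult_mat[OF A[OF x] A[OF cl(2)] B[OF h], symmetric] mult(1)[OF x cl(2), symmetric]
          r_inv[OF x] one(1) by (rule left_mult_one_mat[OF B[OF h]])
      also have "A x * (B (inv x) * D h) = A x * B (inv x) * D h"
        by (rule assoc_mult_mat[OF A[OF x] B[OF cl(2)] D[OF h], symmetric])
      finally show ?thesis unfolding iv .
    qed
    have F: "c \<cdot>\<^sub>m (A g * B (inv g)) \<in> carrier_mat m k" if "g \<in> carrier G" for g
      using A[OF that] B[of "inv g"] that by simp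
    have "A h * X = A h * mat_sum (carrier G) (\<lambda>x. c \<cdot>\<^sub>m (A (inv h \<otimes> x) * B (inv (inv h \<otimes> x)))) m k"
      unfolding X_def by (subst mat_sum_reindex[OF bij]) simp
    also have "\<dots> = mat_sum (carrier G) (\<lambda>x. A h * (c \<cdot>\<^sub>m (A (inv h \<otimes> x) * B (inv (inv h \<otimes> x))))) m k"
      by (rule mult_mat_sum[OF A[OF h]]) (use F h in auto)
    also have "\<dots> = mat_sum (carrier G) (\<lambda>x. c \<cdot>\<^sub>m (B h + A x * B (inv x) * D h)) m k"
      by (rule mat_sum_cong[OF step])
    also have "\<dots> = B h + mat_sum (carrier G) (\<lambda>x. c \<cdot>\<^sub>m (A x * B (inv x)) * D h) m k"
    proof (rule eq_matI)
      let ?Y = "\<lambda>x. A x * B (inv x) * D h"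
      have Y: "?Y x \<in> carrier_mat m k" if "x \<in> carrier G" for x
        using A[OF that] B[of "inv x"] D[OF h] that by auto
      have Y': "c \<cdot>\<^sub>m (A x * B (inv x)) * D h = c \<cdot>\<^sub>m ?Y x" if "x \<in> carrier G" for x
        by (rule mult_smult_assoc_mat[OF mult_carrier_mat[OF A[OF that] B] D[OF h]]) (use that in simp)
      fix i j assume "i < dim_row (B h + mat_sum (carrier G) (\<lambda>x. c \<cdot>\<^sub>m (A x * B (inv x)) * D h) m k)"
        "j < dim_col (B h + mat_sum (carrier G) (\<lambda>x. c \<cdot>\<^sub>m (A x * B (inv x)) * D h) m k)"
      hence ij: "i < m" "j < k" by auto
      have "mat_sum (carrier G) (\<lambda>x. c \<cdot>\<^sub>m (B h + ?Y x)) m k $$ (i, j) =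
          (\<Sum>x\<in>carrier G. c * B h $$ (i, j) + c * ?Y x $$ (i, j))"
        unfolding mat_sum_index[OF ij]
      proof (rule sum.cong[OF refl])
        fix x assume "x \<in> carrier G"
        from Y[OF this] show "(c \<cdot>\<^sub>m (B h + ?Y x)) $$ (i, j) = c * B h $$ (i, j) + c * ?Y x $$ (i, j)"
          by (rule smult_add_index[OF B[OF h] _ ij])
      qed
      also have "\<dots> = B h $$ (i, j) + (\<Sum>x\<in>carrier G. c * ?Y x $$ (i, j))"
        by (simp only: sum.distrib cN)
      also have "(\<Sum>x\<in>carrier G. c * ?Y x $$ (i, j)) =
          mat_sum (carrier G) (\<lambda>x. c \<cdot>\<^sub>m (A x * B (inv x)) * D h) m k $$ (i, j)"
        unfolding mat_sum_index[OF ij]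
      proof (rule sum.cong[OF refl])
        fix x assume x: "x \<in> carrier G"
        from Y[OF this] show "c * ?Y x $$ (i, j) = (c \<cdot>\<^sub>m (A x * B (inv x)) * D h) $$ (i, j)"
          unfolding Y'[OF x] using ij by (intro index_smult_mat(1)[symmetric]) auto
      qed
      finally show "mat_sum (carrier G) (\<lambda>x. c \<cdot>\<^sub>m (B h + ?Y x)) m k $$ (i, j) =
          (B h + mat_sum (carrier G) (\<lambda>x. c \<cdot>\<^sub>m (A x * B (inv x)) * D h) m k) $$ (i, j)"
        using ij by simp
    qed (use B[OF h] in auto)
    also have "mat_sum (carrier G) (\<lambda>x. c \<cdot>\<^sub>m (A x * B (inv x)) * D h) m k = X * D h"
      unfolding X_def by (rule mat_sum_mult[OF D[OF h] F, symmetric])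
    finally show ?thesis .
  qed
  show "rep_iso G \<rho> (rep_dsum A D)"
  proof (rule rep_isoI[OF r is_rep_dsum[OF rA rD], of
        "four_block_mat (1\<^sub>m m) X (0\<^sub>m k m) (1\<^sub>m k)" "four_block_mat (1\<^sub>m m) (- X) (0\<^sub>m k m) (1\<^sub>m k)"])
    have "X + - X = 0\<^sub>m m k" using Xc by (intro eq_matI) auto
    thus "four_block_mat (1\<^sub>m m) (- X) (0\<^sub>m k m) (1\<^sub>m k) * four_block_mat (1\<^sub>m m) X (0\<^sub>m k m) (1\<^sub>m k) = 1\<^sub>m (m + k)"
      using Xc by (subst mult_four_block_mat[of _ m m _ k _ k _ _ m _ k]) auto
    fix g assume g: "g \<in> carrier G"
    show "four_block_mat (1\<^sub>m m) X (0\<^sub>m k m) (1\<^sub>m k) * \<rho> g = rep_dsum A D g * four_block_mat (1\<^sub>m m) X (0\<^sub>m k m) (1\<^sub>m k)"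
      unfolding rep_dsum_eq[OF rA rD g] blk[OF g]
      using A[OF g] B[OF g] D[OF g] Xc key[OF g]
      by (subst mult_four_block_mat[of _ m m _ k _ k _ _ m _ k], simp_all)
        (subst mult_four_block_mat[of _ m m _ k _ k _ _ m _ k], simp_all)
  qed (use Xc in auto)
qed

lemma is_rep_conj:
  assumes r: "is_rep G n \<rho>" and P: "P \<in> carrier_mat n n" and Q: "Q \<in> carrier_mat n n"
    and QP: "Q * P = 1\<^sub>m n" and PQ: "P * Q = 1\<^sub>m n"
  shows "is_rep G n (\<lambda>g. Q * \<rho> g * P)" "rep_iso G \<rho> (\<lambda>g. Q * \<rho> g * P)"
proof -
  have can: "P * (Q * Y) = Y" if "Y \<in> carrier_mat n n" for Y
    using assoc_mult_mat[OF P Q that] PQ that by simp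
  show r': "is_rep G n (\<lambda>g. Q * \<rho> g * P)"
    unfolding is_rep_def
  proof (intro conjI ballI)
    fix g assume g: "g \<in> carrier G"
    note cg = is_rep_carrier[OF r g]
    show "Q * \<rho> g * P \<in> carrier_mat n n" using P Q cg by simp
    fix h assume h: "h \<in> carrier G"
    note ch = is_rep_carrier[OF r h]
    have "Q * \<rho> g * P * (Q * \<rho> h * P) = Q * \<rho> g * (P * (Q * (\<rho> h * P)))"
      using P Q cg ch by (simp add: assoc_mult_mat[of _ n n _ n _ n])
    also have "\<dots> = Q * \<rho> g * (\<rho> h * P)" using can[of "\<rho> h * P"] ch P by simp
    also have "\<dots> = Q * \<rho> (g \<otimes> h) * P"
      unfolding is_rep_mult[OF r g h] using P Q cg ch by (simp add: assoc_mult_mat[of _ n n _ n _ n])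
    finally show "Q * \<rho> (g \<otimes> h) * P = Q * \<rho> g * P * (Q * \<rho> h * P)" by simp
  next
    show "Q * \<rho> \<one> * P = 1\<^sub>m n" using is_rep_one[OF r] Q QP by simp
  qed
  show "rep_iso G \<rho> (\<lambda>g. Q * \<rho> g * P)"
  proof (rule rep_isoI[OF r r' Q P PQ])
    fix g assume g: "g \<in> carrier G"
    note cg = is_rep_carrier[OF r g]
    show "Q * \<rho> g = Q * \<rho> g * P * Q"
      using assoc_mult_mat[of "Q * \<rho> g" n n P n Q n] P Q cg PQ by simp
  qed
qed

lemma simple_repI:
  assumes "is_rep G n \<rho>" "n \<noteq> 0"
    "\<And>W. vsub n W \<Longrightarrow> (\<And>g w. g \<in> carrier G \<Longrightarrow> w \<in> W \<Longrightarrow> \<rho> g *\<^sub>v w \<in> W) \<Longrightarrow> W = {0\<^sub>v n} \<or> W = carrier_vec n"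
  shows "simple_rep G \<rho>"
  unfolding simple_rep_def subspace_iff_vsub is_rep_dim[OF assms(1)]
proof (intro conjI allI impI)
  show "group_rep G \<rho>" by (rule is_rep_group_rep[OF assms(1)])
  show "n \<noteq> 0" by (rule assms(2))
  fix W assume "vsub n W \<and> (\<forall>g\<in>carrier G. \<forall>w\<in>W. \<rho> g *\<^sub>v w \<in> W)"
  thus "W = {0\<^sub>v n} \<or> W = carrier_vec n" using assms(3)[of W] by blast
qed

lemma simple_repD:
  assumes "simple_rep G \<rho>"
  shows "is_rep G (rep_dim G \<rho>) \<rho>" "rep_dim G \<rho> \<noteq> 0"
    "vsub (rep_dim G \<rho>) W \<Longrightarrow> (\<And>g w. g \<in> carrier G \<Longrightarrow> w \<in> W \<Longrightarrow> \<rho> g *\<^sub>v w \<in> W) \<Longrightarrow>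
       W = {0\<^sub>v (rep_dim G \<rho>)} \<or> W = carrier_vec (rep_dim G \<rho>)"
proof -
  have *: "group_rep G \<rho>" "rep_dim G \<rho> \<noteq> 0"
    "\<forall>W. vsub (rep_dim G \<rho>) W \<and> (\<forall>g\<in>carrier G. \<forall>w\<in>W. \<rho> g *\<^sub>v w \<in> W) \<longrightarrow>
       W = {0\<^sub>v (rep_dim G \<rho>)} \<or> W = carrier_vec (rep_dim G \<rho>)"
    using assms unfolding simple_rep_def subspace_iff_vsub by simp_all
  show "is_rep G (rep_dim G \<rho>) \<rho>" using *(1) group_rep_iff[of \<rho> "rep_dim G \<rho>"] by simp
  show "rep_dim G \<rho> \<noteq> 0" by (rule *(2))
  show "W = {0\<^sub>v (rep_dim G \<rho>)} \<or> W = carrier_vec (rep_dim G \<rho>)"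
    if "vsub (rep_dim G \<rho>) W" "\<And>g w. g \<in> carrier G \<Longrightarrow> w \<in> W \<Longrightarrow> \<rho> g *\<^sub>v w \<in> W"
    using *(3) that by simp
qed

lemma non_simple_splits:
  assumes r: "is_rep G n \<rho>" and n: "n \<noteq> 0" and ns: "\<not> simple_rep G \<rho>"
  shows "\<exists>m k A D. 0 < m \<and> 0 < k \<and> m + k = n \<and> is_rep G m A \<and> is_rep G k D \<and> rep_iso G \<rho> (rep_dsum A D)"
proof -
  obtain W where W: "vsub n W" "W \<noteq> {0\<^sub>v n}" "W \<noteq> carrier_vec n"
    and inv: "\<And>g w. g \<in> carrier G \<Longrightarrow> w \<in> W \<Longrightarrow> \<rho> g *\<^sub>v w \<in> W"
    using simple_repI[OF r n] ns by blast
  obtain m k P Q where mk: "0 < m" "0 < k" "m + k = n" and P: "P \<in> carrier_mat n n" and Q: "Q \<in> carrier_mat n n"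
    and QP: "Q * P = 1\<^sub>m n" and PQ: "P * Q = 1\<^sub>m n"
    and zero: "\<forall>A\<in>carrier_mat n n. (\<forall>w\<in>W. A *\<^sub>v w \<in> W) \<longrightarrow>
      (\<forall>i<n. \<forall>j<m. m \<le> i \<longrightarrow> (Q * A * P) $$ (i, j) = 0)"
    using vsub_adapted_basis[OF W] by blast
  define \<sigma> where "\<sigma> = (\<lambda>g. Q * \<rho> g * P)"
  note s = is_rep_conj[OF r P Q QP PQ, folded \<sigma>_def]
  define A where "A = (\<lambda>g. mat m m (\<lambda>(i, j). \<sigma> g $$ (i, j)))"
  define B where "B = (\<lambda>g. mat m k (\<lambda>(i, j). \<sigma> g $$ (i, m + j)))"
  define D where "D = (\<lambda>g. mat k k (\<lambda>(i, j). \<sigma> g $$ (m + i, m + j)))"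
  have blk: "\<sigma> g = four_block_mat (A g) (B g) (0\<^sub>m k m) (D g)" if g: "g \<in> carrier G" for g
  proof (rule eq_matI)
    have c: "\<sigma> g \<in> carrier_mat n n" by (rule is_rep_carrier[OF s(1) g])
    show "dim_row (\<sigma> g) = dim_row (four_block_mat (A g) (B g) (0\<^sub>m k m) (D g))"
      "dim_col (\<sigma> g) = dim_col (four_block_mat (A g) (B g) (0\<^sub>m k m) (D g))"
      using c mk by (auto simp: A_def D_def)
    fix i j assume ij: "i < dim_row (four_block_mat (A g) (B g) (0\<^sub>m k m) (D g))"
      "j < dim_col (four_block_mat (A g) (B g) (0\<^sub>m k m) (D g))"
    hence "i < n" "j < n" using mk by (auto simp: A_def D_def)
    moreover have "\<sigma> g $$ (i, j) = 0" if "i < n" "m \<le> i" "j < m"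
      using zero is_rep_carrier[OF r g] inv[OF g] that by (simp add: \<sigma>_def)
    ultimately show "\<sigma> g $$ (i, j) = four_block_mat (A g) (B g) (0\<^sub>m k m) (D g) $$ (i, j)"
      using mk by (auto simp: A_def B_def D_def)
  qed
  have "is_rep G (m + k) \<sigma>" using s(1) mk by simp
  note ms = maschke[OF this blk]
  have "is_rep G m A" "is_rep G k D" "rep_iso G \<sigma> (rep_dsum A D)"
    using ms by (auto simp: A_def B_def D_def)
  thus ?thesis using rep_iso_trans[OF s(2) _ r s(1)] is_rep_dsum[of m A k D] mk by blast
qed

theorem complete_reducibility:
  assumes "is_rep G n \<rho>"
  shows "\<exists>\<tau>s. (\<forall>\<tau>\<in>set \<tau>s. simple_rep G \<tau>) \<and> is_rep G n (rep_sum \<tau>s) \<and> rep_iso G \<rho> (rep_sum \<tau>s)"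
  using assms
proof (induct n arbitrary: \<rho> rule: less_induct)
  case (less n)
  note r = less.prems
  consider "n = 0" | "simple_rep G \<rho>" | "n \<noteq> 0" "\<not> simple_rep G \<rho>" by blast
  thus ?case
  proof cases
    case 1
    have s: "is_rep G 0 (rep_sum [])" using is_rep_sum[of "[]"] by simp
    have "rep_iso G \<rho> (rep_sum [])"
    proof (rule rep_isoI[OF _ s, of _ "1\<^sub>m 0" "1\<^sub>m 0"])
      fix g assume g: "g \<in> carrier G"
      show "1\<^sub>m 0 * \<rho> g = rep_sum [] g * 1\<^sub>m 0"
        using is_rep_carrier[OF r g] 1 by (intro eq_matI) (auto simp: rep_sum_Nil)
    qed (use r 1 in auto)
    thus ?thesis using s 1 by (intro exI[of _ "[]"]) simp
  next
    case 2
    thus ?thesis using rep_iso_refl[OF r] r by (intro exI[of _ "[\<rho>]"]) (simp add: rep_sum_single)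
  next
    case 3
    obtain m k A D where mk: "0 < m" "0 < k" "m + k = n" and A: "is_rep G m A" and D: "is_rep G k D"
      and iso: "rep_iso G \<rho> (rep_dsum A D)" using non_simple_splits[OF r 3] by blast
    obtain \<alpha>s where a: "\<forall>\<tau>\<in>set \<alpha>s. simple_rep G \<tau>" "is_rep G m (rep_sum \<alpha>s)" "rep_iso G A (rep_sum \<alpha>s)"
      using less.hyps[OF _ A] mk by auto
    obtain \<delta>s where d: "\<forall>\<tau>\<in>set \<delta>s. simple_rep G \<tau>" "is_rep G k (rep_sum \<delta>s)" "rep_iso G D (rep_sum \<delta>s)"
      using less.hyps[OF _ D] mk by auto
    have 1: "rep_iso G (rep_dsum A D) (rep_sum (\<alpha>s @ \<delta>s))"
      unfolding rep_sum_append by (rule rep_iso_dsum[OF a(3) d(3) A a(2) D d(2)])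
    have 2: "is_rep G n (rep_sum (\<alpha>s @ \<delta>s))"
      unfolding rep_sum_append using is_rep_dsum[OF a(2) d(2)] mk by simp
    have "is_rep G n (rep_dsum A D)" using is_rep_dsum[OF A D] mk by simp
    with rep_iso_trans[OF iso 1 r _ 2] 2 a d show ?thesis
      by (intro exI[of _ "\<alpha>s @ \<delta>s"]) auto
  qed
qed

end

section \<open>Characters\<close>

subsection \<open>Schur's lemma\<close>

lemma vsub_kernel:
  assumes "X \<in> carrier_mat m n"
  shows "vsub n {v \<in> carrier_vec n. X *\<^sub>v v = 0\<^sub>v m}"
  using assms by (auto simp: vsub_def mult_add_distrib_mat_vec[OF assms] mult_mat_vec[OF assms])

lemma vsub_image:
  assumes X: "X \<in> carrier_mat m n"
  shows "vsub m ((\<lambda>v. X *\<^sub>v v) ` carrier_vec n)"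
  unfolding vsub_def
proof (intro conjI ballI allI)
  show "(\<lambda>v. X *\<^sub>v v) ` carrier_vec n \<subseteq> carrier_vec m"
    by (auto intro: mult_mat_vec_carrier[OF X])
  have "X *\<^sub>v 0\<^sub>v n = 0\<^sub>v m" using X by (intro eq_vecI) auto
  thus "0\<^sub>v m \<in> (\<lambda>v. X *\<^sub>v v) ` carrier_vec n" by (intro image_eqI[of _ _ "0\<^sub>v n"]) auto
next
  fix v w assume "v \<in> (\<lambda>v. X *\<^sub>v v) ` carrier_vec n" "w \<in> (\<lambda>v. X *\<^sub>v v) ` carrier_vec n"
  then obtain a b where ab: "a \<in> carrier_vec n" "b \<in> carrier_vec n" "v = X *\<^sub>v a" "w = X *\<^sub>v b"
    by (elim imageE) simp
  have "v + w = X *\<^sub>v (a + b)" using mult_add_distrib_mat_vec[OF X ab(1,2)] ab by simp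
  thus "v + w \<in> (\<lambda>v. X *\<^sub>v v) ` carrier_vec n" using add_carrier_vec[OF ab(1,2)] by (rule image_eqI)
next
  fix c v assume "v \<in> (\<lambda>v. X *\<^sub>v v) ` carrier_vec n"
  then obtain a where a: "a \<in> carrier_vec n" "v = X *\<^sub>v a" by (elim imageE) simp
  have "c \<cdot>\<^sub>v v = X *\<^sub>v (c \<cdot>\<^sub>v a)" using mult_mat_vec[OF X a(1)] a by simp
  thus "c \<cdot>\<^sub>v v \<in> (\<lambda>v. X *\<^sub>v v) ` carrier_vec n" using iffD2[OF smult_carrier_vec a(1)] by (rule image_eqI)
qed

lemma vec_eq_of_diff:
  fixes v w :: "complex vec"
  assumes "w \<in> carrier_vec n" "v \<in> carrier_vec n" "w + (-1) \<cdot>\<^sub>v v = 0\<^sub>v n"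
  shows "w = v"
proof (rule eq_vecI)
  fix i assume i: "i < dim_vec v"
  have "(w + (-1) \<cdot>\<^sub>v v) $ i = 0" using assms i by simp
  thus "w $ i = v $ i" using assms(1,2) i by simp
qed (use assms in auto)

lemma complex_eigenvector:
  assumes X: "(X :: complex mat) \<in> carrier_mat n n" and n: "n \<noteq> 0"
  obtains c v where "v \<in> carrier_vec n" "v \<noteq> 0\<^sub>v n" "X *\<^sub>v v = c \<cdot>\<^sub>v v"
proof -
  have "degree (char_poly X) = n" using degree_monic_char_poly[OF X] by simp
  hence "\<not> constant (poly (char_poly X))" using n by (simp add: constant_degree)
  then obtain c where "poly (char_poly X) c = 0" using fundamental_theorem_of_algebra by blast
  hence "eigenvalue X c" using eigenvalue_root_char_poly[OF X] by simp
  then obtain v where "eigenvector X v c" by (auto simp: eigenvalue_def)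
  thus ?thesis using that X by (auto simp: eigenvector_def)
qed

context fin_group
begin

text \<open>Kernel and image of the intertwiner \<open>X\<close> are invariant subspaces, so \<open>X\<close> is injective and surjective.
  Surjectivity gives a right inverse column by column; injectivity makes it a left inverse.\<close>

lemma schur_invertible:
  assumes t: "simple_rep G \<tau>" and s: "simple_rep G \<sigma>"
    and n: "n = rep_dim G \<tau>" and m: "m = rep_dim G \<sigma>"
    and X: "X \<in> carrier_mat m n" and int: "\<And>g. g \<in> carrier G \<Longrightarrow> X * \<tau> g = \<sigma> g * X" and X0: "X \<noteq> 0\<^sub>m m n"
  shows "\<exists>Y\<in>carrier_mat n m. X * Y = 1\<^sub>m m \<and> Y * X = 1\<^sub>m n"
proof -
  note rt = simple_repD(1)[OF t, folded n] and rs = simple_repD(1)[OF s, folded m]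
  have comm: "X *\<^sub>v (\<tau> g *\<^sub>v v) = \<sigma> g *\<^sub>v (X *\<^sub>v v)" if g: "g \<in> carrier G" and v: "v \<in> carrier_vec n" for g v
    using assoc_mult_mat_vec[OF X is_rep_carrier[OF rt g] v] int[OF g]
      assoc_mult_mat_vec[OF is_rep_carrier[OF rs g] X v] by simp
  have Xv: "\<exists>v\<in>carrier_vec n. X *\<^sub>v v \<noteq> 0\<^sub>v m"
  proof (rule ccontr)
    assume *: "\<not> ?thesis"
    have "X = 0\<^sub>m m n"
      by (rule eq_mat_by_mult_vec[OF X zero_carrier_mat]) (use * in auto)
    thus False using X0 by simp
  qed
  let ?K = "{v \<in> carrier_vec n. X *\<^sub>v v = 0\<^sub>v m}"
  have "?K = {0\<^sub>v n} \<or> ?K = carrier_vec n"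
  proof (rule simple_repD(3)[OF t, folded n])
    show "vsub n ?K" by (rule vsub_kernel[OF X])
    fix g w assume g: "g \<in> carrier G" and w: "w \<in> ?K"
    have "\<sigma> g *\<^sub>v 0\<^sub>v m = 0\<^sub>v m" using is_rep_carrier[OF rs g] by auto
    thus "\<tau> g *\<^sub>v w \<in> ?K"
      using comm[OF g, of w] w mult_mat_vec_carrier[OF is_rep_carrier[OF rt g], of w] by simp
  qed
  hence ker: "v = 0\<^sub>v n" if "v \<in> carrier_vec n" "X *\<^sub>v v = 0\<^sub>v m" for v
    using Xv that by blast
  let ?I = "(\<lambda>v. X *\<^sub>v v) ` carrier_vec n"
  have "?I = {0\<^sub>v m} \<or> ?I = carrier_vec m"
  proof (rule simple_repD(3)[OF s, folded m])
    show "vsub m ?I" by (rule vsub_image[OF X])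
    fix g w assume g: "g \<in> carrier G" and "w \<in> ?I"
    then obtain v where v: "v \<in> carrier_vec n" "w = X *\<^sub>v v" by (elim imageE) simp
    have "\<tau> g *\<^sub>v v \<in> carrier_vec n" using mult_mat_vec_carrier[OF is_rep_carrier[OF rt g] v(1)] .
    thus "\<sigma> g *\<^sub>v w \<in> ?I" unfolding v(2) comm[OF g v(1), symmetric] by (rule imageI)
  qed
  hence im: "?I = carrier_vec m" using Xv by blast
  have "\<exists>y\<in>carrier_vec n. X *\<^sub>v y = unit_vec m j" for j
  proof -
    have "unit_vec m j \<in> ?I" unfolding im by simp
    thus ?thesis by (elim imageE) (auto intro!: bexI)
  qed
  then obtain y where y: "\<And>j. y j \<in> carrier_vec n" "\<And>j. X *\<^sub>v y j = unit_vec m j" by metis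
  define Y where "Y = mat n m (\<lambda>(i, j). y j $ i)"
  have Y: "Y \<in> carrier_mat n m" by (simp add: Y_def)
  have XY: "X * Y = 1\<^sub>m m"
  proof (rule eq_matI)
    fix i j assume "i < dim_row (1\<^sub>m m :: complex mat)" "j < dim_col (1\<^sub>m m :: complex mat)"
    hence ij: "i < m" "j < m" by auto
    have "(X * Y) $$ (i, j) = (\<Sum>l<n. X $$ (i, l) * y j $ l)"
      unfolding mult_index_sum[OF X Y ij] using ij by (intro sum.cong) (auto simp: Y_def)
    also have "\<dots> = (X *\<^sub>v y j) $ i" by (rule mult_vec_index_sum[OF X y(1) ij(1), symmetric])
    finally show "(X * Y) $$ (i, j) = 1\<^sub>m m $$ (i, j)" using ij y(2) by simp
  qed (use X Y in auto)
  have "Y * X = 1\<^sub>m n"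
  proof (rule eq_mat_by_mult_vec[of _ n n])
    fix v :: "complex vec" assume v: "v \<in> carrier_vec n"
    have w: "Y * X *\<^sub>v v \<in> carrier_vec n" using X Y v by (intro mult_mat_vec_carrier[of _ n n]) auto
    have "X *\<^sub>v (Y * X *\<^sub>v v) = X *\<^sub>v v"
      using assoc_mult_mat_vec[OF X mult_carrier_mat[OF Y X] v, symmetric]
        assoc_mult_mat[OF X Y X, symmetric] XY X by simp
    hence "X *\<^sub>v (Y * X *\<^sub>v v + (-1) \<cdot>\<^sub>v v) = X *\<^sub>v v + (-1) \<cdot>\<^sub>v (X *\<^sub>v v)"
      using mult_add_distrib_mat_vec[OF X w, of "(-1) \<cdot>\<^sub>v v"] mult_mat_vec[OF X v] v by simp
    also have "\<dots> = 0\<^sub>v m" using X by (intro eq_vecI) auto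
    finally have "Y * X *\<^sub>v v + (-1) \<cdot>\<^sub>v v = 0\<^sub>v n"
      using w v by (intro ker) auto
    hence "Y * X *\<^sub>v v = v" by (rule vec_eq_of_diff[OF w v])
    thus "Y * X *\<^sub>v v = 1\<^sub>m n *\<^sub>v v" using v by simp
  qed (use X Y in auto)
  thus ?thesis using Y XY by blast
qed

lemma schur_iso:
  assumes t: "simple_rep G \<tau>" and s: "simple_rep G \<sigma>"
    and X: "X \<in> carrier_mat (rep_dim G \<sigma>) (rep_dim G \<tau>)"
    and int: "\<And>g. g \<in> carrier G \<Longrightarrow> X * \<tau> g = \<sigma> g * X" and X0: "X \<noteq> 0\<^sub>m (rep_dim G \<sigma>) (rep_dim G \<tau>)"
  shows "rep_iso G \<tau> \<sigma>" "rep_dim G \<tau> = rep_dim G \<sigma>"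
proof -
  obtain Y where Y: "Y \<in> carrier_mat (rep_dim G \<tau>) (rep_dim G \<sigma>)"
    "X * Y = 1\<^sub>m (rep_dim G \<sigma>)" "Y * X = 1\<^sub>m (rep_dim G \<tau>)"
    using schur_invertible[OF t s refl refl X int X0] by blast
  show d: "rep_dim G \<tau> = rep_dim G \<sigma>" using two_sided_inverse_square[OF X Y] by simp
  show "rep_iso G \<tau> \<sigma>"
    by (rule rep_isoI[OF simple_repD(1)[OF t], of _ X Y]) (use simple_repD(1)[OF s] d X Y int in auto)
qed

text \<open>Subtracting an eigenvalue from \<open>X\<close> leaves an intertwiner with a kernel, which must be zero.\<close>

lemma schur_scalar:
  assumes t: "simple_rep G \<tau>" and n: "n = rep_dim G \<tau>"
    and X: "X \<in> carrier_mat n n" and int: "\<And>g. g \<in> carrier G \<Longrightarrow> X * \<tau> g = \<tau> g * X"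
  shows "\<exists>c. X = c \<cdot>\<^sub>m 1\<^sub>m n"
proof -
  note rt = simple_repD(1)[OF t, folded n]
  have "n \<noteq> 0" using simple_repD(2)[OF t] n by simp
  then obtain c v where v: "v \<in> carrier_vec n" "v \<noteq> 0\<^sub>v n" "X *\<^sub>v v = c \<cdot>\<^sub>v v"
    using complex_eigenvector[OF X] by metis
  define Z where "Z = X + (- c) \<cdot>\<^sub>m 1\<^sub>m n"
  have Z: "Z \<in> carrier_mat n n" using X by (simp add: Z_def)
  have Zv: "Z *\<^sub>v v = 0\<^sub>v n"
  proof -
    have "Z *\<^sub>v v = X *\<^sub>v v + ((- c) \<cdot>\<^sub>m 1\<^sub>m n) *\<^sub>v v"
      unfolding Z_def by (rule add_mult_distrib_mat_vec[of _ n n]) (use X v in auto)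
    also have "((- c) \<cdot>\<^sub>m 1\<^sub>m n) *\<^sub>v v = (- c) \<cdot>\<^sub>v v" using v by (intro eq_vecI) auto
    finally show ?thesis using v by (intro eq_vecI) auto
  qed
  have "Z * \<tau> g = \<tau> g * Z" if g: "g \<in> carrier G" for g
  proof -
    note c = is_rep_carrier[OF rt g]
    have "Z * \<tau> g = X * \<tau> g + ((- c) \<cdot>\<^sub>m 1\<^sub>m n) * \<tau> g"
      unfolding Z_def by (rule add_mult_distrib_mat[of _ n n]) (use X c in auto)
    also have "((- c) \<cdot>\<^sub>m 1\<^sub>m n) * \<tau> g = \<tau> g * ((- c) \<cdot>\<^sub>m 1\<^sub>m n)"
      using c by (simp add: mult_smult_distrib[of _ n n _ n] mult_smult_assoc_mat[of _ n n _ n])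
    also have "X * \<tau> g + \<tau> g * ((- c) \<cdot>\<^sub>m 1\<^sub>m n) = \<tau> g * Z"
      unfolding Z_def int[OF g] by (rule mult_add_distrib_mat[of _ n n, symmetric]) (use X c in auto)
    finally show ?thesis .
  qed
  moreover have False if Y: "Y \<in> carrier_mat n n" "Y * Z = 1\<^sub>m n" for Y
  proof -
    have "v = Y *\<^sub>v (Z *\<^sub>v v)" using assoc_mult_mat_vec[OF Y(1) Z v(1), symmetric] Y(2) v by simp
    thus False using Zv Y v by auto
  qed
  ultimately have "Z = 0\<^sub>m n n" using schur_invertible[OF t t n n Z] by blast
  have "X = c \<cdot>\<^sub>m 1\<^sub>m n"
  proof (rule eq_matI)
    fix i j assume "i < dim_row (c \<cdot>\<^sub>m 1\<^sub>m n)" "j < dim_col (c \<cdot>\<^sub>m 1\<^sub>m n)"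
    hence "i < n" "j < n" by auto
    moreover from this have "Z $$ (i, j) = 0" using \<open>Z = 0\<^sub>m n n\<close> by simp
    ultimately show "X $$ (i, j) = (c \<cdot>\<^sub>m 1\<^sub>m n) $$ (i, j)"
      using X by (auto simp: Z_def split: if_splits)
  qed (use X in auto)
  thus ?thesis by blast
qed

subsection \<open>Orthogonality\<close>

text \<open>Summing over the group turns an arbitrary matrix into an intertwiner from \<open>\<tau>\<close> to \<open>\<sigma>\<close>.\<close>

definition avg :: "'a rep \<Rightarrow> 'a rep \<Rightarrow> complex mat \<Rightarrow> complex mat" where
  "avg \<sigma> \<tau> E = mat_sum (carrier G) (\<lambda>g. \<sigma> g * E * \<tau> (inv g)) (dim_row E) (dim_col E)"

lemma avg_intertwines:
  assumes s: "is_rep G m \<sigma>" and t: "is_rep G n \<tau>" and E: "E \<in> carrier_mat m n" and h: "h \<in> carrier G"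
  shows "avg \<sigma> \<tau> E * \<tau> h = \<sigma> h * avg \<sigma> \<tau> E"
proof -
  have bij: "bij_betw (\<lambda>x. h \<otimes> x) (carrier G) (carrier G)"
    by (rule bij_betw_byWitness[where f' = "\<lambda>x. inv h \<otimes> x"])
      (use h in \<open>auto simp: m_assoc[symmetric]\<close>)
  have F: "\<sigma> g * E * \<tau> (inv g) \<in> carrier_mat m n" if "g \<in> carrier G" for g
    using is_rep_carrier[OF s that] is_rep_carrier[OF t inv_closed[OF that]] E by simp
  have "avg \<sigma> \<tau> E * \<tau> h = mat_sum (carrier G) (\<lambda>x. \<sigma> (h \<otimes> x) * E * \<tau> (inv (h \<otimes> x))) m n * \<tau> h"
    unfolding avg_def carrier_matD[OF E] by (subst mat_sum_reindex[OF bij]) (rule refl)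
  also have "\<dots> = mat_sum (carrier G) (\<lambda>x. \<sigma> (h \<otimes> x) * E * \<tau> (inv (h \<otimes> x)) * \<tau> h) m n"
    by (rule mat_sum_mult[OF is_rep_carrier[OF t h]]) (use F h in simp)
  also have "\<dots> = mat_sum (carrier G) (\<lambda>x. \<sigma> h * (\<sigma> x * E * \<tau> (inv x))) m n"
  proof (rule mat_sum_cong)
    fix x assume x: "x \<in> carrier G"
    have cl: "h \<otimes> x \<in> carrier G" "inv (h \<otimes> x) \<in> carrier G" "inv x \<in> carrier G" using h x by auto
    note cs = is_rep_carrier[OF s cl(1)] is_rep_carrier[OF s h] is_rep_carrier[OF s x]
    note ct = is_rep_carrier[OF t cl(2)] is_rep_carrier[OF t h] is_rep_carrier[OF t cl(3)]
    have "\<sigma> (h \<otimes> x) * E * \<tau> (inv (h \<otimes> x)) * \<tau> h = \<sigma> (h \<otimes> x) * E * (\<tau> (inv (h \<otimes> x)) * \<tau> h)"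
      by (rule assoc_mult_mat[OF mult_carrier_mat[OF cs(1) E] ct(1,2)])
    also have "\<tau> (inv (h \<otimes> x)) * \<tau> h = \<tau> (inv x)"
      using is_rep_mult[OF t cl(2) h] h x by (simp add: inv_mult_group m_assoc)
    also have "\<sigma> (h \<otimes> x) * E * \<tau> (inv x) = \<sigma> h * (\<sigma> x * E * \<tau> (inv x))"
      unfolding is_rep_mult[OF s h x] assoc_mult_mat[OF cs(2,3) E]
      by (rule assoc_mult_mat[OF cs(2) mult_carrier_mat[OF cs(3) E] ct(3)])
    finally show "\<sigma> (h \<otimes> x) * E * \<tau> (inv (h \<otimes> x)) * \<tau> h = \<sigma> h * (\<sigma> x * E * \<tau> (inv x))" .
  qed
  also have "\<dots> = \<sigma> h * avg \<sigma> \<tau> E"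
    unfolding avg_def carrier_matD[OF E] by (rule mult_mat_sum[OF is_rep_carrier[OF s h] F, symmetric])
  finally show ?thesis .
qed

lemma avg_carrier: "E \<in> carrier_mat m n \<Longrightarrow> avg \<sigma> \<tau> E \<in> carrier_mat m n"
  by (auto simp: avg_def)

text \<open>The inner product of characters up to the factor \<open>\<bar>G\<bar>\<close>, with \<open>inv g\<close> in place of complex
  conjugation.\<close>

definition char_ip :: "'a rep \<Rightarrow> 'a rep \<Rightarrow> complex" where
  "char_ip \<sigma> \<tau> = (\<Sum>g\<in>carrier G. mat_trace (\<sigma> g) * mat_trace (\<tau> (inv g)))"

definition unit_mat :: "nat \<Rightarrow> nat \<Rightarrow> nat \<Rightarrow> nat \<Rightarrow> complex mat" where
  "unit_mat m n a b = mat m n (\<lambda>(i, j). if i = a \<and> j = b then 1 else 0)"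

lemma unit_mat_carrier: "unit_mat m n a b \<in> carrier_mat m n"
  by (simp add: unit_mat_def)

lemma mult_unit_mat_mult:
  assumes A: "A \<in> carrier_mat m m" and B: "B \<in> carrier_mat n n" and a: "a < m" and b: "b < n"
    and ij: "i < m" "j < n"
  shows "(A * unit_mat m n a b * B) $$ (i, j) = A $$ (i, a) * B $$ (b, j)"
proof -
  have 1: "(A * unit_mat m n a b) $$ (i, l) = (if l = b then A $$ (i, a) else 0)" if l: "l < n" for l
  proof -
    have "(A * unit_mat m n a b) $$ (i, l) = (\<Sum>k<m. if k = a then (if l = b then A $$ (i, a) else 0) else 0)"
      unfolding mult_index_sum[OF A unit_mat_carrier ij(1) l]
      using l by (intro sum.cong) (auto simp: unit_mat_def)
    thus ?thesis using a by simp
  qed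
  have "(A * unit_mat m n a b * B) $$ (i, j) = (\<Sum>l<n. if l = b then A $$ (i, a) * B $$ (b, j) else 0)"
    unfolding mult_index_sum[OF mult_carrier_mat[OF A unit_mat_carrier] B ij]
    using 1 by (intro sum.cong) (auto simp del: index_mult_mat(1))
  thus ?thesis using b by simp
qed

text \<open>The entry \<open>(a, b)\<close> of the averaged matrix unit at \<open>(a, b)\<close> is the sum over \<open>g\<close> of
  \<open>\<sigma> g $$ (a, a) * \<tau> (inv g) $$ (b, b)\<close>.\<close>

lemma char_ip_eq_avg:
  assumes s: "is_rep G m \<sigma>" and t: "is_rep G n \<tau>"
  shows "char_ip \<sigma> \<tau> = (\<Sum>a<m. \<Sum>b<n. avg \<sigma> \<tau> (unit_mat m n a b) $$ (a, b))"
proof -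
  have "char_ip \<sigma> \<tau> = (\<Sum>g\<in>carrier G. \<Sum>a<m. \<Sum>b<n. \<sigma> g $$ (a, a) * \<tau> (inv g) $$ (b, b))"
    unfolding char_ip_def
  proof (rule sum.cong[OF refl])
    fix g assume g: "g \<in> carrier G"
    show "mat_trace (\<sigma> g) * mat_trace (\<tau> (inv g)) = (\<Sum>a<m. \<Sum>b<n. \<sigma> g $$ (a, a) * \<tau> (inv g) $$ (b, b))"
      using is_rep_carrier[OF s g] is_rep_carrier[OF t inv_closed[OF g]]
      by (simp add: mat_trace_def sum_product)
  qed
  also have "\<dots> = (\<Sum>a<m. \<Sum>g\<in>carrier G. \<Sum>b<n. \<sigma> g $$ (a, a) * \<tau> (inv g) $$ (b, b))"
    by (rule sum.swap)
  also have "\<dots> = (\<Sum>a<m. \<Sum>b<n. \<Sum>g\<in>carrier G. \<sigma> g $$ (a, a) * \<tau> (inv g) $$ (b, b))"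
    by (intro sum.cong refl sum.swap)
  also have "\<dots> = (\<Sum>a<m. \<Sum>b<n. avg \<sigma> \<tau> (unit_mat m n a b) $$ (a, b))"
  proof (intro sum.cong refl)
    fix a b assume ab: "a \<in> {..<m}" "b \<in> {..<n}"
    have "avg \<sigma> \<tau> (unit_mat m n a b) $$ (a, b) =
        (\<Sum>g\<in>carrier G. (\<sigma> g * unit_mat m n a b * \<tau> (inv g)) $$ (a, b))"
      unfolding avg_def using ab by (simp add: unit_mat_def del: index_mult_mat(1))
    also have "\<dots> = (\<Sum>g\<in>carrier G. \<sigma> g $$ (a, a) * \<tau> (inv g) $$ (b, b))"
    proof (rule sum.cong[OF refl])
      fix g assume g: "g \<in> carrier G"
      show "(\<sigma> g * unit_mat m n a b * \<tau> (inv g)) $$ (a, b) = \<sigma> g $$ (a, a) * \<tau> (inv g) $$ (b, b)"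
        using mult_unit_mat_mult[OF is_rep_carrier[OF s g] is_rep_carrier[OF t inv_closed[OF g]]] ab by simp
    qed
    finally show "(\<Sum>g\<in>carrier G. \<sigma> g $$ (a, a) * \<tau> (inv g) $$ (b, b)) = avg \<sigma> \<tau> (unit_mat m n a b) $$ (a, b)"
      by simp
  qed
  finally show ?thesis .
qed

lemma char_ip_non_iso:
  assumes s: "simple_rep G \<sigma>" and t: "simple_rep G \<tau>" and ni: "\<not> rep_iso G \<tau> \<sigma>"
  shows "char_ip \<sigma> \<tau> = 0"
proof -
  let ?m = "rep_dim G \<sigma>" and ?n = "rep_dim G \<tau>"
  note rs = simple_repD(1)[OF s] and rt = simple_repD(1)[OF t]
  have "avg \<sigma> \<tau> (unit_mat ?m ?n a b) = 0\<^sub>m ?m ?n" for a b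
    using schur_iso(1)[OF t s avg_carrier[OF unit_mat_carrier] avg_intertwines[OF rs rt unit_mat_carrier]] ni
    by blast
  thus ?thesis unfolding char_ip_eq_avg[OF rs rt] by simp
qed

text \<open>The averaged matrix unit at \<open>(a, b)\<close> is a scalar matrix by Schur's lemma, and averaging multiplies
  the trace by \<open>\<bar>G\<bar>\<close>; so the scalar is \<open>\<bar>G\<bar> / n\<close> for \<open>a = b\<close> and \<open>0\<close> otherwise.\<close>

lemma char_ip_self:
  assumes t: "simple_rep G \<tau>"
  shows "char_ip \<tau> \<tau> = of_nat (card (carrier G))"
proof -
  define n where "n = rep_dim G \<tau>"
  note rt = simple_repD(1)[OF t, folded n_def]
  have n0: "n \<noteq> 0" using simple_repD(2)[OF t] by (simp add: n_def)
  have e: "avg \<tau> \<tau> (unit_mat n n a b) $$ (a, b) = (if a = b then of_nat (card (carrier G)) / of_nat n else 0)"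
    if ab: "a < n" "b < n" for a b
  proof -
    let ?E = "unit_mat n n a b"
    obtain c where c: "avg \<tau> \<tau> ?E = c \<cdot>\<^sub>m 1\<^sub>m n"
      using schur_scalar[OF t n_def avg_carrier[OF unit_mat_carrier] avg_intertwines[OF rt rt unit_mat_carrier]] by blast
    have tr: "mat_trace ?E = (if a = b then 1 else 0)"
    proof -
      have "mat_trace ?E = (\<Sum>i<n. if i = a then (if a = b then 1 else 0) else 0)"
        by (auto simp: mat_trace_def unit_mat_def intro!: sum.cong)
      thus ?thesis using ab by simp
    qed
    have "c * of_nat n = mat_trace (avg \<tau> \<tau> ?E)" unfolding c by simp
    also have "\<dots> = (\<Sum>g\<in>carrier G. mat_trace (\<tau> g * ?E * \<tau> (inv g)))"
      unfolding avg_def carrier_matD[OF unit_mat_carrier]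
      by (rule mat_trace_mat_sum)
        (intro mult_carrier_mat[of _ n n] is_rep_carrier[OF rt] unit_mat_carrier inv_closed)
    also have "\<dots> = (\<Sum>g\<in>carrier G. mat_trace ?E)"
    proof (rule sum.cong[OF refl])
      fix g assume g: "g \<in> carrier G"
      note cg = is_rep_carrier[OF rt g] is_rep_carrier[OF rt inv_closed[OF g]]
      have "mat_trace (\<tau> g * ?E * \<tau> (inv g)) = mat_trace (\<tau> (inv g) * (\<tau> g * ?E))"
        by (rule mat_trace_comm[OF mult_carrier_mat[OF cg(1) unit_mat_carrier] cg(2)])
      also have "\<tau> (inv g) * (\<tau> g * ?E) = ?E"
        using assoc_mult_mat[OF cg(2,1) unit_mat_carrier, symmetric] is_rep_inv(1)[OF rt g]
          left_mult_one_mat[OF unit_mat_carrier] by simp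
      finally show "mat_trace (\<tau> g * ?E * \<tau> (inv g)) = mat_trace ?E" .
    qed
    finally have "c * of_nat n = of_nat (card (carrier G)) * mat_trace ?E" by simp
    thus ?thesis unfolding c tr using ab n0 by (auto simp: field_simps)
  qed
  have "char_ip \<tau> \<tau> = (\<Sum>a<n. \<Sum>b<n. if a = b then of_nat (card (carrier G)) / of_nat n else 0)"
    unfolding char_ip_eq_avg[OF rt rt] by (intro sum.cong refl) (use e in auto)
  also have "\<dots> = of_nat (card (carrier G))" using n0 by simp
  finally show ?thesis .
qed

lemma char_ip_simple_cases:
  assumes "simple_rep G \<sigma>" "simple_rep G \<tau>"
  shows "char_ip \<sigma> \<tau> = (if rep_iso G \<tau> \<sigma> then of_nat (card (carrier G)) else 0)"
proof (cases "rep_iso G \<tau> \<sigma>")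
  case True
  have "char_ip \<sigma> \<tau> = char_ip \<tau> \<tau>"
    unfolding char_ip_def
    by (intro sum.cong refl)
      (simp add: rep_iso_trace[OF True simple_repD(1)[OF assms(2)] simple_repD(1)[OF assms(1)]])
  thus ?thesis using True char_ip_self[OF assms(2)] by simp
qed (use char_ip_non_iso[OF assms] in simp)

subsection \<open>Representations with equal characters\<close>

lemma char_ip_sum_list:
  "(\<Sum>g\<in>carrier G. (\<Sum>\<sigma>\<leftarrow>\<sigma>s. mat_trace (\<sigma> g)) * mat_trace (\<tau> (inv g))) = (\<Sum>\<sigma>\<leftarrow>\<sigma>s. char_ip \<sigma> \<tau>)"
  by (induct \<sigma>s) (simp_all add: char_ip_def distrib_right sum.distrib)

lemma is_rep_sum_simple:
  assumes "\<And>\<tau>. \<tau> \<in> set \<tau>s \<Longrightarrow> simple_rep G \<tau>"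
  shows "is_rep G (sum_list (map (rep_dim G) \<tau>s)) (rep_sum \<tau>s)"
  by (rule is_rep_sum[of \<tau>s "rep_dim G"]) (use assms simple_repD(1) in blast)

lemma rep_sum_rotate_iso:
  assumes "\<And>\<tau>. \<tau> \<in> set (\<alpha>s @ \<sigma> # \<beta>s) \<Longrightarrow> simple_rep G \<tau>"
  shows "rep_iso G (rep_sum (\<sigma> # \<alpha>s @ \<beta>s)) (rep_sum (\<alpha>s @ \<sigma> # \<beta>s))"
proof -
  let ?d = "\<lambda>\<tau>s. sum_list (map (rep_dim G) \<tau>s)"
  have a: "is_rep G (?d \<alpha>s) (rep_sum \<alpha>s)" and s: "is_rep G (rep_dim G \<sigma>) \<sigma>" and b: "is_rep G (?d \<beta>s) (rep_sum \<beta>s)"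
    using assms by (auto intro!: is_rep_sum_simple simple_repD(1))
  have eq1: "rep_sum (\<sigma> # \<alpha>s @ \<beta>s) = rep_dsum (rep_dsum \<sigma> (rep_sum \<alpha>s)) (rep_sum \<beta>s)"
    using rep_sum_append[of "\<sigma> # \<alpha>s" \<beta>s] by (simp add: rep_sum_Cons)
  have eq2: "rep_sum (\<alpha>s @ \<sigma> # \<beta>s) = rep_dsum (rep_dsum (rep_sum \<alpha>s) \<sigma>) (rep_sum \<beta>s)"
    using rep_sum_append[of "\<alpha>s @ [\<sigma>]" \<beta>s] rep_sum_append[of \<alpha>s "[\<sigma>]"] by (simp add: rep_sum_single)
  have sa: "is_rep G (rep_dim G \<sigma> + ?d \<alpha>s) (rep_dsum \<sigma> (rep_sum \<alpha>s))" by (rule is_rep_dsum[OF s a])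
  have as: "is_rep G (rep_dim G \<sigma> + ?d \<alpha>s) (rep_dsum (rep_sum \<alpha>s) \<sigma>)"
    using is_rep_dsum[OF a s] by (simp add: add.commute)
  show ?thesis unfolding eq1 eq2
    by (rule rep_iso_dsum[OF rep_iso_dsum_comm[OF s a] rep_iso_refl[OF b] sa as b b])
qed

text \<open>The inner product with the first summand \<open>\<tau>\<close> counts the summands isomorphic to \<open>\<tau>\<close>, so one occurs
  in \<open>\<sigma>s\<close>; it is moved to the front and cancelled against \<open>\<tau>\<close>.\<close>

lemma simple_sums_iso:
  assumes "\<And>\<tau>. \<tau> \<in> set \<tau>s \<Longrightarrow> simple_rep G \<tau>" "\<And>\<sigma>. \<sigma> \<in> set \<sigma>s \<Longrightarrow> simple_rep G \<sigma>"
    and "\<And>g. g \<in> carrier G \<Longrightarrow> (\<Sum>\<tau>\<leftarrow>\<tau>s. mat_trace (\<tau> g)) = (\<Sum>\<sigma>\<leftarrow>\<sigma>s. mat_trace (\<sigma> g))"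
  shows "rep_iso G (rep_sum \<tau>s) (rep_sum \<sigma>s)"
  using assms
proof (induct \<tau>s arbitrary: \<sigma>s)
  case Nil
  have "(\<Sum>\<sigma>\<leftarrow>\<sigma>s. of_nat (rep_dim G \<sigma>)) = (\<Sum>\<sigma>\<leftarrow>\<sigma>s. mat_trace (\<sigma> \<one>))"
    using Nil(2) by (intro arg_cong[where f = sum_list] map_cong) (auto simp: is_rep_one[OF simple_repD(1)])
  also have "\<dots> = 0" using Nil(3)[of \<one>] by simp
  finally have "of_nat (\<Sum>\<sigma>\<leftarrow>\<sigma>s. rep_dim G \<sigma>) = (0 :: complex)"
    by (simp only: sum_list_of_nat[symmetric] map_map comp_def)
  hence "(\<Sum>\<sigma>\<leftarrow>\<sigma>s. rep_dim G \<sigma>) = 0" by (simp only: of_nat_eq_0_iff)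
  hence "\<sigma>s = []" using Nil(2) simple_repD(2) by (cases \<sigma>s) auto
  thus ?case using rep_iso_refl[OF is_rep_sum_simple[of "[]"]] by simp
next
  case (Cons \<tau> \<tau>s)
  let ?N = "of_nat (card (carrier G)) :: complex"
  have st: "simple_rep G \<tau>" and sts: "\<And>\<alpha>. \<alpha> \<in> set \<tau>s \<Longrightarrow> simple_rep G \<alpha>" using Cons.prems(1) by auto
  have "(\<Sum>\<sigma>\<leftarrow>\<sigma>s. char_ip \<sigma> \<tau>) = (\<Sum>\<sigma>\<leftarrow>\<tau> # \<tau>s. char_ip \<sigma> \<tau>)"
    unfolding char_ip_sum_list[symmetric] by (intro sum.cong refl) (use Cons.prems(3) in simp)
  also have "(\<Sum>\<sigma>\<leftarrow>\<tau>s. char_ip \<sigma> \<tau>) = ?N * of_nat (length (filter (\<lambda>\<sigma>. rep_iso G \<tau> \<sigma>) \<tau>s))"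
    using sts by (induct \<tau>s) (simp_all add: char_ip_simple_cases[OF _ st] distrib_left)
  hence "(\<Sum>\<sigma>\<leftarrow>\<tau> # \<tau>s. char_ip \<sigma> \<tau>) = ?N * of_nat (Suc (length (filter (\<lambda>\<sigma>. rep_iso G \<tau> \<sigma>) \<tau>s)))"
    by (simp add: char_ip_self[OF st] distrib_left)
  hence "(\<Sum>\<sigma>\<leftarrow>\<tau> # \<tau>s. char_ip \<sigma> \<tau>) \<noteq> 0"
    using card_carrier_nonzero by (simp del: of_nat_Suc list.map)
  finally have "(\<Sum>\<sigma>\<leftarrow>\<sigma>s. char_ip \<sigma> \<tau>) \<noteq> 0" .
  moreover have "(\<Sum>\<sigma>\<leftarrow>\<sigma>s. char_ip \<sigma> \<tau>) = 0" if "\<forall>\<sigma>\<in>set \<sigma>s. \<not> rep_iso G \<tau> \<sigma>"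
    using that Cons.prems(2) by (induct \<sigma>s) (simp_all add: char_ip_simple_cases[OF _ st])
  ultimately obtain \<sigma> where "\<sigma> \<in> set \<sigma>s" and iso: "rep_iso G \<tau> \<sigma>" by blast
  then obtain \<alpha>s \<beta>s where split: "\<sigma>s = \<alpha>s @ \<sigma> # \<beta>s" by (meson split_list)
  have ss: "simple_rep G \<sigma>" and sab: "\<And>\<alpha>. \<alpha> \<in> set (\<alpha>s @ \<beta>s) \<Longrightarrow> simple_rep G \<alpha>"
    using Cons.prems(2) split by auto
  note rt = simple_repD(1)[OF st] and rs = simple_repD(1)[OF ss]
  have "rep_iso G (rep_sum \<tau>s) (rep_sum (\<alpha>s @ \<beta>s))"
  proof (rule Cons.hyps[OF sts sab])
    fix g assume g: "g \<in> carrier G"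
    show "(\<Sum>\<tau>\<leftarrow>\<tau>s. mat_trace (\<tau> g)) = (\<Sum>\<sigma>\<leftarrow>\<alpha>s @ \<beta>s. mat_trace (\<sigma> g))"
      using Cons.prems(3)[OF g] rep_iso_trace[OF iso rt rs g] by (simp add: split)
  qed
  note iso' = this
  have r1: "is_rep G (sum_list (map (rep_dim G) \<tau>s)) (rep_sum \<tau>s)" by (rule is_rep_sum_simple[OF sts])
  have r2: "is_rep G (sum_list (map (rep_dim G) (\<alpha>s @ \<beta>s))) (rep_sum (\<alpha>s @ \<beta>s))" by (rule is_rep_sum_simple[OF sab])
  have d: "sum_list (map (rep_dim G) (\<alpha>s @ \<beta>s)) = sum_list (map (rep_dim G) \<tau>s)"
    using iso' is_rep_dim[OF r1] is_rep_dim[OF r2] by (simp add: rep_iso_def)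
  have ds: "rep_dim G \<sigma> = rep_dim G \<tau>" using iso by (simp add: rep_iso_def)
  have i1: "rep_iso G (rep_sum (\<tau> # \<tau>s)) (rep_sum (\<sigma> # \<alpha>s @ \<beta>s))"
    unfolding rep_sum_Cons by (rule rep_iso_dsum[OF iso iso' rt rs[unfolded ds] r1 r2[unfolded d]])
  have i2: "rep_iso G (rep_sum (\<sigma> # \<alpha>s @ \<beta>s)) (rep_sum \<sigma>s)"
    unfolding split by (rule rep_sum_rotate_iso) (use Cons.prems(2) split in auto)
  let ?n = "rep_dim G \<tau> + sum_list (map (rep_dim G) \<tau>s)"
  show ?case
  proof (rule rep_iso_trans[OF i1 i2, of ?n])
    show "is_rep G ?n (rep_sum (\<tau> # \<tau>s))" using is_rep_sum_simple[of "\<tau> # \<tau>s"] Cons.prems(1) by simp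
    show "is_rep G ?n (rep_sum (\<sigma> # \<alpha>s @ \<beta>s))" using is_rep_sum_simple[of "\<sigma> # \<alpha>s @ \<beta>s"] ss sab ds d by auto
    have "sum_list (map (rep_dim G) \<sigma>s) = ?n" using ds d by (simp add: split)
    thus "is_rep G ?n (rep_sum \<sigma>s)" using is_rep_sum_simple[of \<sigma>s] Cons.prems(2) by simp
  qed
qed

theorem equal_characters_iso:
  assumes r: "is_rep G n \<rho>" and s: "is_rep G m \<sigma>"
    and eq: "\<And>g. g \<in> carrier G \<Longrightarrow> mat_trace (\<rho> g) = mat_trace (\<sigma> g)"
  shows "rep_iso G \<rho> \<sigma>"
proof -
  have "of_nat n = (of_nat m :: complex)"
    using eq[OF one_closed] is_rep_one[OF r] is_rep_one[OF s] by simp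
  hence nm: "m = n" by simp
  obtain \<rho>s where 1: "\<forall>\<tau>\<in>set \<rho>s. simple_rep G \<tau>" "is_rep G n (rep_sum \<rho>s)" "rep_iso G \<rho> (rep_sum \<rho>s)"
    using complete_reducibility[OF r] by blast
  obtain \<sigma>s where 2: "\<forall>\<tau>\<in>set \<sigma>s. simple_rep G \<tau>" "is_rep G n (rep_sum \<sigma>s)" "rep_iso G \<sigma> (rep_sum \<sigma>s)"
    using complete_reducibility[OF s] nm by blast
  have "rep_iso G (rep_sum \<rho>s) (rep_sum \<sigma>s)"
  proof (rule simple_sums_iso)
    fix g assume g: "g \<in> carrier G"
    have "(\<Sum>\<tau>\<leftarrow>\<rho>s. mat_trace (\<tau> g)) = mat_trace (rep_sum \<rho>s g)"
      by (rule trace_rep_sum[of _ "rep_dim G", symmetric]) (use 1 g simple_repD(1) in auto)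
    also have "\<dots> = mat_trace (rep_sum \<sigma>s g)"
      using rep_iso_trace[OF 1(3) r 1(2) g] rep_iso_trace[OF 2(3) s 2(2) g] eq[OF g] by simp
    also have "\<dots> = (\<Sum>\<tau>\<leftarrow>\<sigma>s. mat_trace (\<tau> g))"
      by (rule trace_rep_sum[of _ "rep_dim G"]) (use 2 g simple_repD(1) in auto)
    finally show "(\<Sum>\<tau>\<leftarrow>\<rho>s. mat_trace (\<tau> g)) = (\<Sum>\<tau>\<leftarrow>\<sigma>s. mat_trace (\<tau> g))" .
  qed (use 1 2 in auto)
  from rep_iso_trans[OF 1(3) this r 1(2) 2(2)]
  have "rep_iso G \<rho> (rep_sum \<sigma>s)" .
  from rep_iso_trans[OF this rep_iso_sym[OF 2(3)] r 2(2)] show ?thesis using s 2(2) nm by simp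
qed

end

section \<open>The regular representation and the Knutson index\<close>

context fin_group
begin

lemma carrier_enum: "distinct (carrier_enum G)" "set (carrier_enum G) = carrier G"
proof -
  have "\<exists>xs. distinct xs \<and> set xs = carrier G" using finite_distinct_list[OF fin] by blast
  hence "distinct (carrier_enum G) \<and> set (carrier_enum G) = carrier G"
    unfolding carrier_enum_def by (rule someI_ex)
  thus "distinct (carrier_enum G)" "set (carrier_enum G) = carrier G" by auto
qed

lemma length_carrier_enum: "length (carrier_enum G) = Coset.order G"
  using carrier_enum distinct_card[of "carrier_enum G"] by (simp add: Coset.order_def)

lemma carrier_enum_nth: "i < Coset.order G \<Longrightarrow> carrier_enum G ! i \<in> carrier G"
  using carrier_enum(2) length_carrier_enum nth_mem by metis

lemma carrier_enum_nth_eq: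
  "i < Coset.order G \<Longrightarrow> j < Coset.order G \<Longrightarrow> carrier_enum G ! i = carrier_enum G ! j \<longleftrightarrow> i = j"
  using carrier_enum(1) length_carrier_enum by (simp add: nth_eq_iff_index_eq)

lemma is_rep_regular: "is_rep G (Coset.order G) (regular_rep G)"
proof -
  define N where "N = Coset.order G"
  define e where "e = (\<lambda>i. carrier_enum G ! i)"
  have ec: "e i \<in> carrier G" if "i < N" for i using carrier_enum_nth that by (simp add: N_def e_def)
  have einj: "e i = e j \<longleftrightarrow> i = j" if "i < N" "j < N" for i j
    using carrier_enum_nth_eq that by (simp add: N_def e_def)
  have esurj: "\<exists>i<N. e i = x" if "x \<in> carrier G" for x
    using that carrier_enum(2) length_carrier_enum unfolding N_def e_def by (metis in_set_conv_nth)
  have R: "regular_rep G g = mat N N (\<lambda>(i, j). if e i = g \<otimes> e j then 1 else 0)" for g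
    by (simp add: regular_rep_def N_def e_def)
  have c: "regular_rep G g \<in> carrier_mat N N" for g by (simp add: R)
  have "regular_rep G (g \<otimes> h) = regular_rep G g * regular_rep G h"
    if g: "g \<in> carrier G" and h: "h \<in> carrier G" for g h
  proof (rule eq_matI)
    fix i j assume "i < dim_row (regular_rep G g * regular_rep G h)" "j < dim_col (regular_rep G g * regular_rep G h)"
    hence ij: "i < N" "j < N" by (simp_all add: R)
    obtain k where k: "k < N" "e k = h \<otimes> e j" using esurj[of "h \<otimes> e j"] ec ij h by auto
    have uniq: "e l = h \<otimes> e j \<longleftrightarrow> l = k" if "l < N" for l
      using einj[OF that k(1)] k(2) by simp
    have "(regular_rep G g * regular_rep G h) $$ (i, j) =
        (\<Sum>l<N. regular_rep G g $$ (i, l) * regular_rep G h $$ (l, j))"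
      by (rule mult_index_sum[OF c c ij])
    also have "\<dots> = (\<Sum>l<N. if l = k then (if e i = g \<otimes> e k then 1 else 0) else 0)"
      using ij by (intro sum.cong) (auto simp: R uniq)
    also have "\<dots> = (if e i = (g \<otimes> h) \<otimes> e j then 1 else 0)"
      using k ij g h ec by (simp add: m_assoc)
    finally show "regular_rep G (g \<otimes> h) $$ (i, j) = (regular_rep G g * regular_rep G h) $$ (i, j)"
      using ij by (simp add: R)
  qed (simp_all add: R)
  moreover have "regular_rep G \<one> = 1\<^sub>m N"
    by (rule eq_matI) (auto simp: R ec einj)
  ultimately show ?thesis using c by (simp add: is_rep_def N_def)
qed

lemma trace_regular:
  assumes g: "g \<in> carrier G"
  shows "mat_trace (regular_rep G g) = (if g = \<one> then of_nat (card (carrier G)) else 0)"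
proof -
  have "mat_trace (regular_rep G g) =
      (\<Sum>i<Coset.order G. if carrier_enum G ! i = g \<otimes> carrier_enum G ! i then 1 else 0)"
    by (simp add: mat_trace_def regular_rep_def)
  also have "\<dots> = (\<Sum>i<Coset.order G. if g = \<one> then 1 else 0)"
    using carrier_enum_nth g by (intro sum.cong) (auto simp: r_cancel_one)
  finally show ?thesis by (simp add: Coset.order_def)
qed

text \<open>A solution \<open>M\<close> on the level of characters suffices: the simple constituents of \<open>M\<close>, each with
  coefficient \<open>1\<close>, form the virtual module.\<close>

lemma knutson_index_one:
  assumes r: "is_rep G n \<rho>" and M: "is_rep G m M"
    and tr: "\<And>g. g \<in> carrier G \<Longrightarrow>
      mat_trace (\<rho> g) * mat_trace (M g) = (if g = \<one> then of_nat (card (carrier G)) else 0)"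
  shows "knutson_index G \<rho> = 1"
proof -
  obtain \<tau>s where ts: "\<forall>\<tau>\<in>set \<tau>s. simple_rep G \<tau>" "is_rep G m (rep_sum \<tau>s)" "rep_iso G M (rep_sum \<tau>s)"
    using complete_reducibility[OF M] by blast
  define N where "N = map (\<lambda>\<tau>. (1 :: int, \<tau>)) \<tau>s"
  have N: "virtual_module G N" using ts(1) by (auto simp: virtual_module_def N_def)
  have parts: "pos_part (comb_tensor \<rho> N) = map (rep_tensor \<rho>) \<tau>s" "neg_part (comb_tensor \<rho> N) = []"
    unfolding N_def by (induct \<tau>s) (simp_all add: pos_part_def neg_part_def comb_tensor_def)
  have parts': "pos_part [(int 1, regular_rep G)] = [regular_rep G]" "neg_part [(int 1, regular_rep G)] = []"
    by (simp_all add: pos_part_def neg_part_def)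
  \<comment> \<open>The last entry of either list is the module added to both sides in the definition of equality in
     the representation ring.\<close>
  let ?A = "map (rep_tensor \<rho>) \<tau>s @ [regular_rep G]" and ?B = "[regular_rep G, regular_rep G]"
  have A: "is_rep G (rep_dim G \<sigma>) \<sigma>" if "\<sigma> \<in> set ?A" for \<sigma>
    using that ts(1) is_rep_tensor[OF r simple_repD(1)] is_rep_regular is_rep_dim by fastforce
  have B: "is_rep G (rep_dim G \<sigma>) \<sigma>" if "\<sigma> \<in> set ?B" for \<sigma>
    using that is_rep_regular is_rep_dim by fastforce
  have "rep_iso G (rep_sum ?A) (rep_sum ?B)"
  proof (rule equal_characters_iso[OF is_rep_sum[OF A] is_rep_sum[OF B]])
    fix g assume g: "g \<in> carrier G"
    have "(\<Sum>\<tau>\<leftarrow>\<tau>s. mat_trace (\<tau> g)) = mat_trace (rep_sum \<tau>s g)"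
      by (rule trace_rep_sum[of _ "rep_dim G", symmetric]) (use ts(1) g simple_repD(1) in auto)
    also have "\<dots> = mat_trace (M g)" using rep_iso_trace[OF ts(3) M ts(2) g] by simp
    finally have s: "(\<Sum>\<tau>\<leftarrow>\<tau>s. mat_trace (\<tau> g)) = mat_trace (M g)" .
    have "(\<Sum>\<sigma>\<leftarrow>map (rep_tensor \<rho>) \<tau>s. mat_trace (\<sigma> g)) = (\<Sum>\<tau>\<leftarrow>\<tau>s. mat_trace (\<rho> g) * mat_trace (\<tau> g))"
      unfolding map_map comp_def
      by (intro arg_cong[where f = sum_list] map_cong refl trace_tensor[OF r simple_repD(1) g]) (use ts(1) in auto)
    also have "\<dots> = mat_trace (\<rho> g) * mat_trace (M g)" by (simp add: sum_list_const_mult s)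
    also have "\<dots> = mat_trace (regular_rep G g)" using tr[OF g] trace_regular[OF g] by simp
    finally have e: "(\<Sum>\<sigma>\<leftarrow>map (rep_tensor \<rho>) \<tau>s. mat_trace (\<sigma> g)) = mat_trace (regular_rep G g)" .
    have "mat_trace (rep_sum ?A g) = (\<Sum>\<sigma>\<leftarrow>?A. mat_trace (\<sigma> g))"
      by (rule trace_rep_sum[of _ "rep_dim G"]) (use A g in auto)
    also have "\<dots> = (\<Sum>\<sigma>\<leftarrow>?B. mat_trace (\<sigma> g))" using e by simp
    also have "\<dots> = mat_trace (rep_sum ?B g)"
      by (rule trace_rep_sum[of _ "rep_dim G", symmetric]) (use B g in auto)
    finally show "mat_trace (rep_sum ?A g) = mat_trace (rep_sum ?B g)" .
  qed
  hence "rep_ring_eq G (comb_tensor \<rho> N) [(int 1, regular_rep G)]"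
    unfolding rep_ring_eq_def parts parts'
    by (intro exI[of _ "regular_rep G"]) (simp add: is_rep_group_rep[OF is_rep_regular])
  hence "\<exists>N. virtual_module G N \<and> rep_ring_eq G (comb_tensor \<rho> N) [(int 1, regular_rep G)]"
    using N by blast
  thus ?thesis unfolding knutson_index_def by (intro Least_equality) auto
qed

end

section \<open>Simple representations of extraspecial groups\<close>

context fin_group
begin

lemma center_carrier: "z \<in> group_center G \<Longrightarrow> z \<in> carrier G"
  by (simp add: group_center_def)

lemma center_commutes: "z \<in> group_center G \<Longrightarrow> g \<in> carrier G \<Longrightarrow> z \<otimes> g = g \<otimes> z"
  by (simp add: group_center_def)

lemma subgroup_center: "subgroup (group_center G) G"
proof (rule subgroupI)
  show "group_center G \<noteq> {}" using one_closed by (force simp: group_center_def)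
next
  fix a assume a: "a \<in> group_center G"
  note ac = center_carrier[OF a]
  have "inv a \<otimes> g = g \<otimes> inv a" if g: "g \<in> carrier G" for g
  proof -
    have "inv a \<otimes> g = inv a \<otimes> (g \<otimes> a) \<otimes> inv a" using g ac by (simp add: m_assoc)
    also have "\<dots> = inv a \<otimes> (a \<otimes> g) \<otimes> inv a" using center_commutes[OF a g] by simp
    also have "\<dots> = g \<otimes> inv a" using g ac by (simp add: m_assoc[symmetric])
    finally show ?thesis .
  qed
  thus "inv a \<in> group_center G" using ac by (simp add: group_center_def)
next
  fix a b assume a: "a \<in> group_center G" and b: "b \<in> group_center G"
  note c = center_carrier[OF a] center_carrier[OF b]
  have "a \<otimes> b \<otimes> g = g \<otimes> (a \<otimes> b)" if g: "g \<in> carrier G" for g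
  proof -
    have "a \<otimes> b \<otimes> g = a \<otimes> g \<otimes> b" using c g center_commutes[OF b g] by (simp add: m_assoc)
    thus ?thesis using c g center_commutes[OF a g] by (simp add: m_assoc)
  qed
  thus "a \<otimes> b \<in> group_center G" using c by (simp add: group_center_def)
qed (auto dest: center_carrier)

lemma normal_center: "group_center G \<lhd> G"
  unfolding normal_inv_iff
proof (intro conjI ballI subgroup_center)
  fix x h assume x: "x \<in> carrier G" and h: "h \<in> group_center G"
  have "x \<otimes> h \<otimes> inv x = h"
    using center_commutes[OF h x, symmetric] x center_carrier[OF h] by (simp add: m_assoc)
  thus "x \<otimes> h \<otimes> inv x \<in> group_center G" using h by simp
qed

text \<open>Commutators die in the abelian quotient, so they are central.\<close>

lemma abelian_quotient_commutator:
  assumes ab: "comm_group (G Mod group_center G)" and g: "g \<in> carrier G" and h: "h \<in> carrier G"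
  shows "\<exists>z\<in>group_center G. g \<otimes> h = z \<otimes> (h \<otimes> g)"
proof -
  let ?Z = "group_center G"
  interpret N: normal ?Z G by (rule normal_center)
  interpret Q: comm_group "G Mod ?Z" by (rule ab)
  have "?Z #> g \<in> carrier (G Mod ?Z)" "?Z #> h \<in> carrier (G Mod ?Z)"
    using g h by (auto simp: FactGroup_def RCOSETS_def)
  from Q.m_comm[OF this] have "?Z #> (g \<otimes> h) = ?Z #> (h \<otimes> g)"
    using g h by (simp add: N.rcos_sum)
  hence "g \<otimes> h \<in> ?Z #> (h \<otimes> g)" using rcos_self[OF m_closed[OF g h] subgroup_center] by simp
  thus ?thesis by (auto simp: r_coset_def)
qed

lemma simple_center_scalar:
  assumes "simple_rep G \<rho>"
  shows "\<exists>\<omega>. \<forall>z\<in>group_center G. \<rho> z = \<omega> z \<cdot>\<^sub>m 1\<^sub>m (rep_dim G \<rho>)"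
proof -
  note r = simple_repD(1)[OF assms]
  have "\<exists>c. \<rho> z = c \<cdot>\<^sub>m 1\<^sub>m (rep_dim G \<rho>)" if z: "z \<in> group_center G" for z
  proof (rule schur_scalar[OF assms refl is_rep_carrier[OF r center_carrier[OF z]]])
    fix g assume g: "g \<in> carrier G"
    show "\<rho> z * \<rho> g = \<rho> g * \<rho> z"
      using center_commutes[OF z g] is_rep_mult[OF r] center_carrier[OF z] g by metis
  qed
  thus ?thesis by metis
qed

text \<open>The function \<open>\<omega>\<close> is the central character of \<open>\<rho>\<close>. That \<open>\<omega>\<close> is a homomorphism
  follows when \<open>n \<noteq> 0\<close>.\<close>

definition center_acts :: "nat \<Rightarrow> 'a rep \<Rightarrow> ('a \<Rightarrow> complex) \<Rightarrow> bool" where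
  "center_acts n \<rho> \<omega> \<longleftrightarrow> (\<forall>z\<in>group_center G. \<rho> z = \<omega> z \<cdot>\<^sub>m 1\<^sub>m n)"

lemma smult_one_mat_eq_iff:
  "n \<noteq> 0 \<Longrightarrow> a \<cdot>\<^sub>m 1\<^sub>m n = (b \<cdot>\<^sub>m 1\<^sub>m n :: complex mat) \<longleftrightarrow> a = b"
proof
  assume "n \<noteq> 0" and e: "a \<cdot>\<^sub>m 1\<^sub>m n = (b \<cdot>\<^sub>m 1\<^sub>m n :: complex mat)"
  from e have "(a \<cdot>\<^sub>m 1\<^sub>m n) $$ (0, 0) = (b \<cdot>\<^sub>m 1\<^sub>m n :: complex mat) $$ (0, 0)" by simp
  thus "a = b" using \<open>n \<noteq> 0\<close> by simp
qed simp

lemma center_acts_hom: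
  assumes r: "is_rep G n \<rho>" and n: "n \<noteq> 0" and a: "center_acts n \<rho> \<omega>"
  shows "\<omega> \<one> = 1" "\<And>z w. z \<in> group_center G \<Longrightarrow> w \<in> group_center G \<Longrightarrow> \<omega> (z \<otimes> w) = \<omega> z * \<omega> w"
proof -
  have one: "\<one> \<in> group_center G" by (rule subgroup.one_closed[OF subgroup_center])
  have "\<omega> \<one> \<cdot>\<^sub>m 1\<^sub>m n = 1 \<cdot>\<^sub>m (1\<^sub>m n :: complex mat)"
    using a one is_rep_one[OF r] by (simp add: center_acts_def) (auto intro!: eq_matI)
  thus "\<omega> \<one> = 1" using smult_one_mat_eq_iff[OF n] by blast
  fix z w assume z: "z \<in> group_center G" and w: "w \<in> group_center G"
  have zw: "z \<otimes> w \<in> group_center G" by (rule subgroup.m_closed[OF subgroup_center z w])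
  have "\<omega> (z \<otimes> w) \<cdot>\<^sub>m 1\<^sub>m n = (\<omega> z \<cdot>\<^sub>m 1\<^sub>m n) * (\<omega> w \<cdot>\<^sub>m 1\<^sub>m n)"
    using a z w zw is_rep_mult[OF r center_carrier[OF z] center_carrier[OF w]] by (simp add: center_acts_def)
  also have "\<dots> = (\<omega> z * \<omega> w) \<cdot>\<^sub>m 1\<^sub>m n"
    by (rule eq_matI) (auto simp: mult_smult_assoc_mat[of _ n n _ n] mult_smult_distrib[of _ n n _ n])
  finally show "\<omega> (z \<otimes> w) = \<omega> z * \<omega> w" using smult_one_mat_eq_iff[OF n] by blast
qed

text \<open>A scalar matrix is unchanged by the isomorphism with a direct sum of simple representations, so
  each summand inherits the central character.\<close>

lemma simple_constituent_center:
  assumes M: "is_rep G m M" and m: "m \<noteq> 0" and a: "center_acts m M \<mu>"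
  shows "\<exists>\<sigma>. simple_rep G \<sigma> \<and> center_acts (rep_dim G \<sigma>) \<sigma> \<mu>"
proof -
  obtain \<tau>s where ts: "\<forall>\<tau>\<in>set \<tau>s. simple_rep G \<tau>" "is_rep G m (rep_sum \<tau>s)" "rep_iso G M (rep_sum \<tau>s)"
    using complete_reducibility[OF M] by blast
  have "\<tau>s \<noteq> []"
  proof
    assume "\<tau>s = []"
    hence "m = 0" using is_rep_one[OF ts(2)] by (metis index_one_mat(2) index_zero_mat(2) rep_sum_Nil)
    thus False using m by simp
  qed
  then obtain \<tau> \<tau>s' where t: "\<tau>s = \<tau> # \<tau>s'" by (cases \<tau>s) auto
  have s: "simple_rep G \<tau>" using ts(1) t by simp
  note rt = simple_repD(1)[OF s]
  let ?d = "rep_dim G \<tau>" and ?k = "sum_list (map (rep_dim G) \<tau>s')"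
  have rs: "is_rep G ?k (rep_sum \<tau>s')" by (rule is_rep_sum_simple) (use ts(1) t in auto)
  have mk: "m = ?d + ?k"
    using is_rep_dim[OF ts(2)] is_rep_dim[OF is_rep_dsum[OF rt rs]] by (simp add: t rep_sum_Cons)
  obtain P Q where P: "P \<in> carrier_mat m m" "Q \<in> carrier_mat m m" "P * Q = 1\<^sub>m m"
    "\<And>g. g \<in> carrier G \<Longrightarrow> P * M g = rep_sum \<tau>s g * P"
    using rep_isoE[OF ts(3) M] by metis
  have "\<tau> z = \<mu> z \<cdot>\<^sub>m 1\<^sub>m ?d" if z: "z \<in> group_center G" for z
  proof -
    note zc = center_carrier[OF z]
    note c = is_rep_carrier[OF ts(2) zc]
    have "rep_sum \<tau>s z = rep_sum \<tau>s z * (P * Q)" using P(3) c by simp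
    also have "\<dots> = (P * M z) * Q" using assoc_mult_mat[OF c P(1,2)] P(4)[OF zc] by simp
    also have "M z = \<mu> z \<cdot>\<^sub>m 1\<^sub>m m" using a z by (simp add: center_acts_def)
    also have "P * (\<mu> z \<cdot>\<^sub>m 1\<^sub>m m) = \<mu> z \<cdot>\<^sub>m P"
      using mult_smult_distrib[OF P(1) one_carrier_mat] P(1) by simp
    also have "(\<mu> z \<cdot>\<^sub>m P) * Q = \<mu> z \<cdot>\<^sub>m 1\<^sub>m m"
      using mult_smult_assoc_mat[OF P(1,2)] P(3) by simp
    finally have e: "four_block_mat (\<tau> z) (0\<^sub>m ?d ?k) (0\<^sub>m ?k ?d) (rep_sum \<tau>s' z) = \<mu> z \<cdot>\<^sub>m 1\<^sub>m m"
      unfolding t rep_sum_Cons rep_dsum_eq[OF rt rs zc] .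
    show ?thesis
    proof (rule eq_matI)
      note ct = is_rep_carrier[OF rt zc] is_rep_carrier[OF rs zc]
      fix i j assume "i < dim_row (\<mu> z \<cdot>\<^sub>m 1\<^sub>m ?d)" "j < dim_col (\<mu> z \<cdot>\<^sub>m 1\<^sub>m ?d)"
      hence ij: "i < ?d" "j < ?d" by auto
      have "\<tau> z $$ (i, j) = four_block_mat (\<tau> z) (0\<^sub>m ?d ?k) (0\<^sub>m ?k ?d) (rep_sum \<tau>s' z) $$ (i, j)"
        using ij ct by simp
      also have "\<dots> = (\<mu> z \<cdot>\<^sub>m 1\<^sub>m ?d) $$ (i, j)" unfolding e using ij mk by simp
      finally show "\<tau> z $$ (i, j) = (\<mu> z \<cdot>\<^sub>m 1\<^sub>m ?d) $$ (i, j)" .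
    qed (use is_rep_carrier[OF rt zc] in auto)
  qed
  thus ?thesis using s by (auto simp: center_acts_def)
qed

text \<open>The center acts on a tensor product through the product of the central characters. Taking a simple
  constituent at every step avoids handling the full tensor powers.\<close>

lemma simple_with_power_char:
  assumes r: "is_rep G n \<rho>" and n: "n \<noteq> 0" and a: "center_acts n \<rho> \<omega>"
  shows "\<exists>\<sigma>. simple_rep G \<sigma> \<and> center_acts (rep_dim G \<sigma>) \<sigma> (\<lambda>z. \<omega> z ^ k)"
proof (induct k)
  case 0
  have "is_rep G 1 (\<lambda>g. 1\<^sub>m 1)" by (simp add: is_rep_def)
  thus ?case
    by (rule simple_constituent_center) (auto simp: center_acts_def intro!: eq_matI)
next
  case (Suc k)
  then obtain \<sigma> where s: "simple_rep G \<sigma>" and c: "center_acts (rep_dim G \<sigma>) \<sigma> (\<lambda>z. \<omega> z ^ k)" by blast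
  show ?case
  proof (rule simple_constituent_center[OF is_rep_tensor[OF r simple_repD(1)[OF s]]])
    show "n * rep_dim G \<sigma> \<noteq> 0" using n simple_repD(2)[OF s] by simp
    show "center_acts (n * rep_dim G \<sigma>) (rep_tensor \<rho> \<sigma>) (\<lambda>z. \<omega> z ^ Suc k)"
      using a c by (simp add: center_acts_def rep_tensor_def kronecker_smult_one)
  qed
qed

lemma trace_center:
  assumes "center_acts n \<rho> \<omega>" "z \<in> group_center G"
  shows "mat_trace (\<rho> z) = \<omega> z * of_nat n"
  using assms by (simp add: center_acts_def)

text \<open>If \<open>g\<close> and \<open>h\<close> do not commute, then \<open>g = z \<otimes> (h \<otimes> g \<otimes> inv h)\<close> for a central \<open>z \<noteq> \<one>\<close>.
  Taking traces gives \<open>t = \<omega> z * t\<close> with \<open>\<omega> z \<noteq> 1\<close>.\<close>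

lemma trace_off_center:
  assumes ab: "comm_group (G Mod group_center G)"
    and r: "is_rep G n \<rho>" and a: "center_acts n \<rho> \<omega>"
    and inj: "\<And>z. z \<in> group_center G \<Longrightarrow> z \<noteq> \<one> \<Longrightarrow> \<omega> z \<noteq> 1"
    and g: "g \<in> carrier G" "g \<notin> group_center G"
  shows "mat_trace (\<rho> g) = 0"
proof -
  obtain h where h: "h \<in> carrier G" "g \<otimes> h \<noteq> h \<otimes> g" using g by (auto simp: group_center_def)
  obtain z where z: "z \<in> group_center G" "g \<otimes> h = z \<otimes> (h \<otimes> g)"
    using abelian_quotient_commutator[OF ab g(1) h(1)] by blast
  note zc = center_carrier[OF z(1)]
  have z1: "z \<noteq> \<one>" using z h g by auto
  have hg: "h \<otimes> g \<otimes> inv h \<in> carrier G" using h g by simp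
  have "g = g \<otimes> h \<otimes> inv h" using g h by (simp add: m_assoc)
  also have "\<dots> = z \<otimes> (h \<otimes> g \<otimes> inv h)" unfolding z(2) using zc h g by (simp add: m_assoc)
  finally have "\<rho> g = \<rho> z * \<rho> (h \<otimes> g \<otimes> inv h)" using is_rep_mult[OF r zc hg] by simp
  also have "\<dots> = \<omega> z \<cdot>\<^sub>m \<rho> (h \<otimes> g \<otimes> inv h)"
    using a z(1) is_rep_carrier[OF r hg] mult_smult_assoc_mat[OF one_carrier_mat is_rep_carrier[OF r hg]]
    by (simp add: center_acts_def)
  finally have "mat_trace (\<rho> g) = \<omega> z * mat_trace (\<rho> (h \<otimes> g \<otimes> inv h))"
    using is_rep_carrier[OF r hg] by (simp add: mat_trace_def sum_distrib_left)
  also have "mat_trace (\<rho> (h \<otimes> g \<otimes> inv h)) = mat_trace (\<rho> (h \<otimes> g) * \<rho> (inv h))"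
    using is_rep_mult[OF r] h g by simp
  also have "\<dots> = mat_trace (\<rho> (inv h) * \<rho> (h \<otimes> g))"
    by (rule mat_trace_comm[of _ n n]) (use is_rep_carrier[OF r] h g in auto)
  also have "\<rho> (inv h) * \<rho> (h \<otimes> g) = \<rho> g"
    using is_rep_mult[OF r, of "inv h" "h \<otimes> g"] h g by (simp add: m_assoc[symmetric])
  finally have "(1 - \<omega> z) * mat_trace (\<rho> g) = 0" by (simp add: algebra_simps)
  thus ?thesis using inj[OF z(1) z1] by simp
qed

text \<open>The norm of the character is \<open>\<bar>G\<bar>\<close>, only central elements contribute to it, and each
  of them contributes the square of the dimension.\<close>

lemma simple_faithful_center_dim:
  assumes ab: "comm_group (G Mod group_center G)"
    and s: "simple_rep G \<rho>" and a: "center_acts (rep_dim G \<rho>) \<rho> \<omega>"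
    and inj: "\<And>z. z \<in> group_center G \<Longrightarrow> z \<noteq> \<one> \<Longrightarrow> \<omega> z \<noteq> 1"
  shows "rep_dim G \<rho> * rep_dim G \<rho> * card (group_center G) = card (carrier G)"
proof -
  let ?n = "rep_dim G \<rho>" and ?Z = "group_center G"
  note r = simple_repD(1)[OF s]
  note hom = center_acts_hom[OF r simple_repD(2)[OF s] a]
  have "of_nat (card (carrier G)) = (\<Sum>g\<in>carrier G. mat_trace (\<rho> g) * mat_trace (\<rho> (inv g)))"
    using char_ip_self[OF s] by (simp add: char_ip_def)
  also have "\<dots> = (\<Sum>g\<in>?Z. mat_trace (\<rho> g) * mat_trace (\<rho> (inv g)))"
    by (rule sum.mono_neutral_right[OF fin])
      (use trace_off_center[OF ab r a inj] center_carrier in auto)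
  also have "\<dots> = (\<Sum>g\<in>?Z. of_nat (?n * ?n))"
  proof (rule sum.cong[OF refl])
    fix z assume z: "z \<in> ?Z"
    have iz: "inv z \<in> ?Z" by (rule subgroup.m_inv_closed[OF subgroup_center z])
    have "\<omega> z * \<omega> (inv z) = 1" using hom(2)[OF z iz] hom(1) center_carrier[OF z] by simp
    thus "mat_trace (\<rho> z) * mat_trace (\<rho> (inv z)) = of_nat (?n * ?n)"
      unfolding trace_center[OF a z] trace_center[OF a iz] by (simp add: algebra_simps)
  qed
  also have "\<dots> = of_nat (?n * ?n * card ?Z)" by simp
  finally show ?thesis by (simp only: of_nat_eq_iff)
qed

text \<open>Commutators are central and act trivially, so the representing matrices commute and are scalar by
  Schur's lemma. Then all group elements contribute the square of the dimension to the norm \<open>\<bar>G\<bar>\<close>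
  of the character.\<close>

lemma simple_trivial_center_dim:
  assumes ab: "comm_group (G Mod group_center G)"
    and s: "simple_rep G \<rho>" and a: "center_acts (rep_dim G \<rho>) \<rho> (\<lambda>_. 1)"
  shows "rep_dim G \<rho> = 1"
proof -
  let ?n = "rep_dim G \<rho>"
  note r = simple_repD(1)[OF s]
  have scalar: "\<exists>c. \<rho> g = c \<cdot>\<^sub>m 1\<^sub>m ?n" if g: "g \<in> carrier G" for g
  proof (rule schur_scalar[OF s refl is_rep_carrier[OF r g]])
    fix h assume h: "h \<in> carrier G"
    obtain z where z: "z \<in> group_center G" "g \<otimes> h = z \<otimes> (h \<otimes> g)"
      using abelian_quotient_commutator[OF ab g h] by blast
    have hg: "h \<otimes> g \<in> carrier G" using g h by simp
    have "\<rho> z = 1\<^sub>m ?n" using a z(1) by (auto simp: center_acts_def intro!: eq_matI)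
    hence "\<rho> (g \<otimes> h) = \<rho> (h \<otimes> g)"
      unfolding z(2) is_rep_mult[OF r center_carrier[OF z(1)] hg]
      using left_mult_one_mat[OF is_rep_carrier[OF r hg]] by simp
    thus "\<rho> g * \<rho> h = \<rho> h * \<rho> g" using is_rep_mult[OF r] g h by simp
  qed
  have "of_nat (card (carrier G)) = (\<Sum>g\<in>carrier G. mat_trace (\<rho> g) * mat_trace (\<rho> (inv g)))"
    using char_ip_self[OF s] by (simp add: char_ip_def)
  also have "\<dots> = (\<Sum>g\<in>carrier G. of_nat (?n * ?n))"
  proof (rule sum.cong[OF refl])
    fix g assume g: "g \<in> carrier G"
    obtain c d where cd: "\<rho> g = c \<cdot>\<^sub>m 1\<^sub>m ?n" "\<rho> (inv g) = d \<cdot>\<^sub>m 1\<^sub>m ?n"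
      using scalar[OF g] scalar[OF inv_closed[OF g]] by blast
    have "(c * d) \<cdot>\<^sub>m 1\<^sub>m ?n = \<rho> g * \<rho> (inv g)"
      unfolding cd by (rule eq_matI) (auto simp: mult_smult_assoc_mat[of _ ?n ?n _ ?n] mult_smult_distrib[of _ ?n ?n _ ?n])
    also have "\<dots> = 1 \<cdot>\<^sub>m 1\<^sub>m ?n" using is_rep_inv(2)[OF r g] by (auto intro!: eq_matI)
    finally have "c * d = 1" using smult_one_mat_eq_iff simple_repD(2)[OF s] by blast
    thus "mat_trace (\<rho> g) * mat_trace (\<rho> (inv g)) = of_nat (?n * ?n)"
      unfolding cd by (simp add: algebra_simps)
  qed
  also have "\<dots> = of_nat (card (carrier G) * (?n * ?n))" by simp
  finally have "card (carrier G) = card (carrier G) * (?n * ?n)" by (simp only: of_nat_eq_iff)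
  moreover have "card (carrier G) \<noteq> 0" using fin one_closed by auto
  ultimately show ?thesis by simp
qed

text \<open>Multiplication by \<open>z\<close> permutes the center, so multiplying the product of all values of \<open>\<omega>\<close> by
  \<open>\<omega> z\<close> to the order of the center does not change it.\<close>

lemma center_hom_power_card:
  assumes hom: "\<omega> \<one> = (1 :: complex)" "\<And>z w. z \<in> group_center G \<Longrightarrow> w \<in> group_center G \<Longrightarrow> \<omega> (z \<otimes> w) = \<omega> z * \<omega> w"
    and z: "z \<in> group_center G"
  shows "\<omega> z ^ card (group_center G) = 1"
proof -
  let ?Z = "group_center G"
  have finZ: "finite ?Z" using fin finite_subset[of ?Z "carrier G"] center_carrier by blast
  have nz: "\<omega> w \<noteq> 0" if w: "w \<in> ?Z" for w
    using hom(2)[OF w subgroup.m_inv_closed[OF subgroup_center w]] hom(1) center_carrier[OF w] by auto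
  have bij: "bij_betw (\<lambda>x. z \<otimes> x) ?Z ?Z"
    by (rule bij_betw_byWitness[where f' = "\<lambda>x. inv z \<otimes> x"])
      (use z subgroup.m_closed[OF subgroup_center] subgroup.m_inv_closed[OF subgroup_center] center_carrier
        in \<open>auto simp: m_assoc[symmetric]\<close>)
  have "(\<Prod>x\<in>?Z. \<omega> x) = (\<Prod>x\<in>?Z. \<omega> (z \<otimes> x))"
    by (rule prod.reindex_bij_betw[OF bij, symmetric])
  also have "\<dots> = \<omega> z ^ card ?Z * (\<Prod>x\<in>?Z. \<omega> x)"
    using hom(2)[OF z] by (simp add: prod.distrib)
  finally show ?thesis using finZ nz by simp
qed

text \<open>The order of the kernel divides a prime.\<close>

lemma prime_center_hom_cases:
  assumes p: "prime (card (group_center G))"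
    and hom: "\<omega> \<one> = (1 :: complex)" "\<And>z w. z \<in> group_center G \<Longrightarrow> w \<in> group_center G \<Longrightarrow> \<omega> (z \<otimes> w) = \<omega> z * \<omega> w"
  shows "(\<forall>z\<in>group_center G. \<omega> z = 1) \<or> (\<forall>z\<in>group_center G. z \<noteq> \<one> \<longrightarrow> \<omega> z \<noteq> 1)"
proof -
  let ?Z = "group_center G" and ?K = "{z \<in> group_center G. \<omega> z = 1}"
  have finZ: "finite ?Z" using fin finite_subset[of ?Z "carrier G"] center_carrier by blast
  have K: "subgroup ?K G"
  proof (rule subgroupI)
    show "?K \<noteq> {}" using hom(1) subgroup.one_closed[OF subgroup_center] by auto
  next
    fix a assume a: "a \<in> ?K"
    hence iv: "inv a \<in> ?Z" using subgroup.m_inv_closed[OF subgroup_center] by simp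
    have "\<omega> a * \<omega> (inv a) = 1" using hom(2)[of a "inv a"] a iv hom(1) center_carrier by simp
    thus "inv a \<in> ?K" using a iv by simp
  next
    show "?K \<subseteq> carrier G" by (auto dest: center_carrier)
    fix a b assume "a \<in> ?K" "b \<in> ?K"
    thus "a \<otimes> b \<in> ?K" using hom(2)[of a b] subgroup.m_closed[OF subgroup_center, of a b] by simp
  qed
  have grp: "group (G\<lparr>carrier := ?Z\<rparr>)" by (rule subgroup.subgroup_is_group[OF subgroup_center is_group])
  have "subgroup ?K (G\<lparr>carrier := ?Z\<rparr>)" by (rule subgroup_incl[OF K subgroup_center Collect_subset])
  from group.lagrange[OF grp this]
  have "card (rcosets\<^bsub>G\<lparr>carrier := ?Z\<rparr>\<^esub> ?K) * card ?K = card ?Z"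
    unfolding Coset.order_def by simp
  hence "card ?K dvd card ?Z" by (intro dvdI[of _ _ "card (rcosets\<^bsub>G\<lparr>carrier := ?Z\<rparr>\<^esub> ?K)"]) (simp only: mult.commute)
  hence "card ?K = 1 \<or> card ?K = card ?Z" using p by (auto simp: prime_nat_iff)
  thus ?thesis
  proof
    assume "card ?K = 1"
    then obtain x where "?K = {x}" by (auto simp: card_1_singleton_iff)
    moreover have "\<one> \<in> ?K" by (rule subgroup.one_closed[OF K])
    ultimately have "?K = {\<one>}" by auto
    thus ?thesis by blast
  next
    assume "card ?K = card ?Z"
    hence "?K = ?Z" using finZ by (intro card_subset_eq) auto
    thus ?thesis by blast
  qed
qed

end

lemma root_of_unity_power_neq_one:
  fixes x :: complex
  assumes p: "prime p" and x: "x ^ p = 1" "x \<noteq> 1" and k: "0 < k" "k < p"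
  shows "x ^ k \<noteq> 1"
proof
  assume xk: "x ^ k = 1"
  have "\<not> p dvd k" using k by (auto dest: dvd_imp_le)
  hence "coprime k p" using p prime_imp_coprime coprime_commute by blast
  then obtain a b where "k * a = p * b + 1"
    using bezout_nat[of k p] k by auto
  hence "(x ^ k) ^ a = (x ^ p) ^ b * x"
    by (simp add: power_mult[symmetric] power_add[symmetric])
  thus False using xk x by simp
qed

lemma sum_powers_root_of_unity:
  fixes x :: complex
  assumes "x ^ p = 1" "x \<noteq> 1"
  shows "(\<Sum>k<p. x ^ k) = 0"
  using geometric_sum[OF assms(2), of p] assms(1) by simp

context fin_group
begin

theorem extraspecial_simple_knutson:
  assumes p: "prime p" and ex: "extraspecial p G" and s: "simple_rep G \<rho>"
  shows "knutson_index G \<rho> = 1"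
proof -
  let ?Z = "group_center G" and ?n = "rep_dim G \<rho>" and ?N = "of_nat (card (carrier G)) :: complex"
  have cp: "card ?Z = p" and ab: "comm_group (G Mod ?Z)"
    using ex by (auto simp: extraspecial_def elementary_abelian_def)
  note r = simple_repD(1)[OF s] and n0 = simple_repD(2)[OF s]
  obtain \<omega> where a: "center_acts ?n \<rho> \<omega>"
    using simple_center_scalar[OF s] by (auto simp: center_acts_def)
  note hom = center_acts_hom[OF r n0 a]
  have oneZ: "\<one> \<in> ?Z" by (rule subgroup.one_closed[OF subgroup_center])
  consider (triv) "\<forall>z\<in>?Z. \<omega> z = 1" | (faithful) "\<forall>z\<in>?Z. z \<noteq> \<one> \<longrightarrow> \<omega> z \<noteq> 1"
    using prime_center_hom_cases[OF _ hom] p cp by blast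
  thus ?thesis
  proof cases
    case triv
    have "?n = 1" by (rule simple_trivial_center_dim[OF ab s]) (use a triv in \<open>simp add: center_acts_def\<close>)
    hence "mat_trace (\<rho> \<one>) = 1" using is_rep_one[OF r] by simp
    thus ?thesis
      by (intro knutson_index_one[OF r is_rep_regular]) (simp add: trace_regular)
  next
    case faithful
    hence inj: "\<omega> z \<noteq> 1" if "z \<in> ?Z" "z \<noteq> \<one>" for z using that by blast
    have pw: "\<omega> z ^ p = 1" if "z \<in> ?Z" for z
      using center_hom_power_card[OF hom that] cp by simp
    have dim: "?n * ?n * p = card (carrier G)"
      using simple_faithful_center_dim[OF ab s a inj] cp by simp
    \<comment> \<open>For \<open>k = 0\<close> no simple module has the right dimension; the multiple of the trivial module by
       \<open>d\<close> takes its place.\<close>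
    have "\<exists>\<sigma>. is_rep G ?n \<sigma> \<and> center_acts ?n \<sigma> (\<lambda>z. \<omega> z ^ k)" if k: "k < p" for k
    proof (cases "k = 0")
      case True
      have "is_rep G ?n (\<lambda>g. 1\<^sub>m ?n)" by (simp add: is_rep_def)
      moreover have "center_acts ?n (\<lambda>g. 1\<^sub>m ?n) (\<lambda>z. \<omega> z ^ k)"
        using True by (auto simp: center_acts_def intro!: eq_matI)
      ultimately show ?thesis by blast
    next
      case False
      obtain \<sigma> where sg: "simple_rep G \<sigma>" "center_acts (rep_dim G \<sigma>) \<sigma> (\<lambda>z. \<omega> z ^ k)"
        using simple_with_power_char[OF r n0 a] by blast
      have "\<omega> z ^ k \<noteq> 1" if "z \<in> ?Z" "z \<noteq> \<one>" for z
        using root_of_unity_power_neq_one[OF p pw inj] that k False by simp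
      from simple_faithful_center_dim[OF ab sg this]
      have "rep_dim G \<sigma> * rep_dim G \<sigma> * p = ?n * ?n * p" using dim cp by simp
      hence "(rep_dim G \<sigma>)\<^sup>2 = ?n\<^sup>2" using p by (simp add: power2_eq_square prime_gt_0_nat)
      hence "rep_dim G \<sigma> = ?n" by simp
      thus ?thesis using sg simple_repD(1)[OF sg(1)] by auto
    qed
    then obtain \<sigma> where sg: "\<And>k. k < p \<Longrightarrow> is_rep G ?n (\<sigma> k)"
      "\<And>k. k < p \<Longrightarrow> center_acts ?n (\<sigma> k) (\<lambda>z. \<omega> z ^ k)" by metis
    define M where "M = rep_sum (map \<sigma> [0..<p])"
    have Mr: "is_rep G (sum_list (map (\<lambda>_. ?n) (map \<sigma> [0..<p]))) M"
      unfolding M_def by (rule is_rep_sum[where d = "\<lambda>_. ?n"]) (use sg(1) in auto)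
    have Mtr: "mat_trace (M g) = (\<Sum>k<p. mat_trace (\<sigma> k g))" if g: "g \<in> carrier G" for g
    proof -
      have "mat_trace (M g) = (\<Sum>\<tau>\<leftarrow>map \<sigma> [0..<p]. mat_trace (\<tau> g))"
        unfolding M_def by (rule trace_rep_sum[where d = "\<lambda>_. ?n", OF _ g]) (use sg(1) in auto)
      thus ?thesis by (simp add: comp_def interv_sum_list_conv_sum_set_nat atLeast0LessThan)
    qed
    have MZ: "mat_trace (M z) = (\<Sum>k<p. \<omega> z ^ k) * of_nat ?n" if z: "z \<in> ?Z" for z
      unfolding Mtr[OF center_carrier[OF z]] sum_distrib_right
      by (intro sum.cong refl) (use trace_center[OF sg(2) z] in simp)
    show ?thesis
    proof (rule knutson_index_one[OF r Mr])
      fix g assume g: "g \<in> carrier G"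
      consider "g \<notin> ?Z" | "g \<in> ?Z" "g \<noteq> \<one>" | "g = \<one>" by blast
      thus "mat_trace (\<rho> g) * mat_trace (M g) = (if g = \<one> then ?N else 0)"
      proof cases
        case 1
        hence "g \<noteq> \<one>" using oneZ by blast
        thus ?thesis using trace_off_center[OF ab r a inj g 1] by simp
      next
        case 2
        thus ?thesis using MZ[OF 2(1)] sum_powers_root_of_unity[OF pw inj] by simp
      next
        case 3
        have "mat_trace (\<rho> \<one>) * mat_trace (M \<one>) = of_nat (?n * ?n * p)"
          using trace_center[OF a oneZ] MZ[OF oneZ] hom(1) by simp
        thus ?thesis using 3 dim by simp
      qed
    qed
  qed
qed

end

theorem mainTheorem7:
  fixes p :: nat and G :: "('a, 'b) monoid_scheme"
  assumes "prime p" and "extraspecial p G"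
  shows "knutson_type G"
proof -
  have G: "group G" and "\<exists>k. Coset.order G = p ^ k" using assms(2) by (auto simp: extraspecial_def)
  hence "Coset.order G > 0" using assms(1) by (auto simp: prime_gt_0_nat)
  hence "finite (carrier G)" by (simp add: Coset.order_def card_gt_0_iff)
  with G interpret fin_group G by (simp add: fin_group_def fin_group_axioms_def)
  show ?thesis unfolding knutson_type_def using extraspecial_simple_knutson[OF assms] by blast
qed

end
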